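(* Let $s\ge 1$, $n=2s$, let $V$ be a $K$-linear space with basis $\{e_{i_1,\dots,i_s}: i_1,\dots,i_s\ge 0\}$, and let $\lambda_1,\dots,\lambda_s\in K$ be nonzero. Then the action of $a_1,\dots,a_n\in C_n$ on $V$ defined by $$a_je_{i_1,\dots,i_s}=\begin{cases}\lambda_j e_{i_1,\dots,i_{j-1},i_j+1,\dots,i_s+1} & \text{if } j\le s,\\ e_{i_1,\dots,i_{n-j},i_{n-j+1}-1,\dots,i_s-1} & \text{if } j>s \text{ and } i_k>0 \text{ for all } k>n-j,\\ 0 & \text{if } j>s\text{ and } i_k=0 \text{ for some } k>n-j\end{cases}$$ makes $V=V(\lambda_1,\dots,\lambda_s)$ a simple left $K[C_n]$-module. Moreover, if $\mu_1,\dots,\mu_s\in K$ are nonzero, then $V(\lambda_1,\dots,\lambda_s)\cong V(\mu_1,\dots,\mu_s)$ as left $K[C_n]$-modules if and only if $\lambda_i=\mu_i$ for all $i=1,\dots,s$.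
   Context: $K$ is a nondenumerable (uncountable) algebraically closed field. For a positive integer $n$, the Chinese monoid of rank $n$ is the monoid $C_n=\langle a_1,\dots,a_n\rangle$ given by the defining relations $a_ja_ka_i=a_ka_ja_i=a_ka_ia_j$ for all $i\le j\le k$; $K[C_n]$ is its monoid algebra. In the formula for the action, for $j\le s$ all indices in positions $j,j+1,\dots,s$ are increased by one and the others are unchanged; for $j>s$ all indices in positions $n-j+1,\dots,s$ are decreased by one (if all of them are positive) and the others are unchanged. *)

theory Defs
  imports
    "HOL-Algebra.Module"
    "HOL-Computational_Algebra.Polynomial"
    "HOL-Library.Countable_Set"
    "HOL-Library.FuncSet"
begin

section \<open>Monoids given by generators and relations\<close>

text \<open>The congruence on the free monoid \<open>lists A\<close> generated by the relations \<open>R\<close>.\<close>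

inductive_set word_cong :: "'a set \<Rightarrow> ('a list \<times> 'a list) set \<Rightarrow> ('a list \<times> 'a list) set"
  for A :: "'a set" and R :: "('a list \<times> 'a list) set" where
  rel: "(u, v) \<in> R \<Longrightarrow> u \<in> lists A \<Longrightarrow> v \<in> lists A \<Longrightarrow> (u, v) \<in> word_cong A R"
| refl: "w \<in> lists A \<Longrightarrow> (w, w) \<in> word_cong A R"
| sym: "(u, v) \<in> word_cong A R \<Longrightarrow> (v, u) \<in> word_cong A R"
| trans: "(u, v) \<in> word_cong A R \<Longrightarrow> (v, w) \<in> word_cong A R \<Longrightarrow> (u, w) \<in> word_cong A R"
| append: "(u, v) \<in> word_cong A R \<Longrightarrow> (u', v') \<in> word_cong A R \<Longrightarrow>
    (u @ u', v @ v') \<in> word_cong A R"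

definition presented_monoid :: "'a set \<Rightarrow> ('a list \<times> 'a list) set \<Rightarrow> 'a list set monoid" where
  "presented_monoid A R =
     \<lparr>carrier = lists A // word_cong A R,
      monoid.mult = (\<lambda>X Y. \<Union>u\<in>X. \<Union>v\<in>Y. word_cong A R `` {u @ v}),
      one = word_cong A R `` {[]}\<rparr>"

definition presented_gen :: "'a set \<Rightarrow> ('a list \<times> 'a list) set \<Rightarrow> 'a \<Rightarrow> 'a list set" where
  "presented_gen A R a = word_cong A R `` {[a]}"


section \<open>The Chinese monoid\<close>

definition chinese_rels :: "nat \<Rightarrow> (nat list \<times> nat list) set" where
  "chinese_rels n =
     {([j, k, i], [k, j, i]) | i j k. 1 \<le> i \<and> i \<le> j \<and> j \<le> k \<and> k \<le> n} \<union>
     {([k, j, i], [k, i, j]) | i j k. 1 \<le> i \<and> i \<le> j \<and> j \<le> k \<and> k \<le> n}"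

definition chinese_monoid :: "nat \<Rightarrow> nat list set monoid" where
  "chinese_monoid n = presented_monoid {1..n} (chinese_rels n)"

definition chinese_gen :: "nat \<Rightarrow> nat \<Rightarrow> nat list set" where
  "chinese_gen n j = presented_gen {1..n} (chinese_rels n) j"


section \<open>Monoid algebras\<close>

text \<open>Elements are the finitely supported functions on the monoid; multiplication is convolution.\<close>

definition monoid_algebra :: "('m, 'r) monoid_scheme \<Rightarrow> ('m \<Rightarrow> 'k::field) ring" where
  "monoid_algebra G =
     \<lparr>carrier = {f. finite {x. f x \<noteq> 0} \<and> {x. f x \<noteq> 0} \<subseteq> carrier G},
      monoid.mult = (\<lambda>f g x. \<Sum>(a, b) \<in> {(a, b). f a \<noteq> 0 \<and> g b \<noteq> 0 \<and> a \<otimes>\<^bsub>G\<^esub> b = x}. f a * g b),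
      one = (\<lambda>x. if x = \<one>\<^bsub>G\<^esub> then 1 else 0),
      zero = (\<lambda>x. 0),
      add = (\<lambda>f g x. f x + g x)\<rparr>"

text \<open>\<open>alg_monom c a\<close> is the element \<open>c \<cdot> a\<close> of the monoid algebra.\<close>

definition alg_monom :: "'k::field \<Rightarrow> 'm \<Rightarrow> 'm \<Rightarrow> 'k" where
  "alg_monom c a = (\<lambda>x. if x = a then c else 0)"


section \<open>Left modules over a ring that need not be commutative\<close>

text \<open>The library locale \<^locale>\<open>Module.module\<close> requires a commutative ring of scalars; the axioms
  below are the same otherwise.\<close>

locale left_module = R?: ring R + M?: abelian_group M
  for R :: "('a, 'r) ring_scheme" (structure) and M :: "('a, 'b, 'm) module_scheme" (structure) +
  assumes smult_closed:
      "\<lbrakk>a \<in> carrier R; x \<in> carrier M\<rbrakk> \<Longrightarrow> a \<odot>\<^bsub>M\<^esub> x \<in> carrier M"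
    and smult_l_distr:
      "\<lbrakk>a \<in> carrier R; b \<in> carrier R; x \<in> carrier M\<rbrakk> \<Longrightarrow>
        (a \<oplus>\<^bsub>R\<^esub> b) \<odot>\<^bsub>M\<^esub> x = (a \<odot>\<^bsub>M\<^esub> x) \<oplus>\<^bsub>M\<^esub> (b \<odot>\<^bsub>M\<^esub> x)"
    and smult_r_distr:
      "\<lbrakk>a \<in> carrier R; x \<in> carrier M; y \<in> carrier M\<rbrakk> \<Longrightarrow>
        a \<odot>\<^bsub>M\<^esub> (x \<oplus>\<^bsub>M\<^esub> y) = (a \<odot>\<^bsub>M\<^esub> x) \<oplus>\<^bsub>M\<^esub> (a \<odot>\<^bsub>M\<^esub> y)"
    and smult_assoc:
      "\<lbrakk>a \<in> carrier R; b \<in> carrier R; x \<in> carrier M\<rbrakk> \<Longrightarrow>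
        (a \<otimes>\<^bsub>R\<^esub> b) \<odot>\<^bsub>M\<^esub> x = a \<odot>\<^bsub>M\<^esub> (b \<odot>\<^bsub>M\<^esub> x)"
    and smult_one:
      "x \<in> carrier M \<Longrightarrow> \<one>\<^bsub>R\<^esub> \<odot>\<^bsub>M\<^esub> x = x"

definition simple_left_module ::
  "('a, 'r) ring_scheme \<Rightarrow> ('a, 'b) module \<Rightarrow> bool" where
  "simple_left_module R M \<longleftrightarrow>
     left_module R M \<and> carrier M \<noteq> {\<zero>\<^bsub>M\<^esub>} \<and>
     (\<forall>N. submodule N R M \<longrightarrow> N = {\<zero>\<^bsub>M\<^esub>} \<or> N = carrier M)"

definition left_module_isomorphic ::
  "('a, 'r) ring_scheme \<Rightarrow> ('a, 'b) module \<Rightarrow> ('a, 'c) module \<Rightarrow> bool" where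
  "left_module_isomorphic R M N \<longleftrightarrow>
     (\<exists>h. bij_betw h (carrier M) (carrier N) \<and>
          (\<forall>x\<in>carrier M. \<forall>y\<in>carrier M. h (x \<oplus>\<^bsub>M\<^esub> y) = h x \<oplus>\<^bsub>N\<^esub> h y) \<and>
          (\<forall>a\<in>carrier R. \<forall>x\<in>carrier M. h (a \<odot>\<^bsub>M\<^esub> x) = a \<odot>\<^bsub>N\<^esub> h x))"

text \<open>The additive group of the type \<open>'v\<close> with scalar multiplication \<open>act\<close>. The record fields
  \<open>mult\<close> and \<open>one\<close> are inherited from rings and play no role for modules.\<close>

definition type_module :: "('a \<Rightarrow> 'v \<Rightarrow> 'v) \<Rightarrow> ('a, 'v::ab_group_add) module" where
  "type_module act =
     \<lparr>carrier = UNIV, monoid.mult = (\<lambda>x y. 0), one = 0, zero = 0, add = (+), module.smult = act\<rparr>"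


section \<open>The modules \<open>V(\<lambda>\<^sub>1, \<dots>, \<lambda>\<^sub>s)\<close>\<close>

text \<open>The tuples \<open>(i\<^sub>1, \<dots>, i\<^sub>s)\<close> of natural numbers.\<close>

definition multi_indices :: "nat \<Rightarrow> (nat \<Rightarrow> nat) set" where
  "multi_indices s = {1..s} \<rightarrow>\<^sub>E UNIV"

definition basis_family ::
  "('k::field \<Rightarrow> 'v::ab_group_add \<Rightarrow> 'v) \<Rightarrow> 'i set \<Rightarrow> ('i \<Rightarrow> 'v) \<Rightarrow> bool" where
  "basis_family scale I e \<longleftrightarrow>
     inj_on e I \<and> \<not> Modules.module.dependent scale (e ` I) \<and>
     Modules.module.span scale (e ` I) = UNIV"

text \<open>The prescribed value of \<open>a\<^sub>j\<close> on the basis vector with index \<open>i\<close>.\<close>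

definition basis_action ::
  "nat \<Rightarrow> nat \<Rightarrow> ('k::field \<Rightarrow> 'v::ab_group_add \<Rightarrow> 'v) \<Rightarrow> ((nat \<Rightarrow> nat) \<Rightarrow> 'v) \<Rightarrow>
   (nat \<Rightarrow> 'k) \<Rightarrow> nat \<Rightarrow> (nat \<Rightarrow> nat) \<Rightarrow> 'v" where
  "basis_action n s scale e lam j i =
     (if j \<le> s then scale (lam j) (e (\<lambda>k\<in>{1..s}. if k < j then i k else i k + 1))
      else if \<forall>k\<in>{n - j + 1..s}. i k > 0
        then e (\<lambda>k\<in>{1..s}. if k \<le> n - j then i k else i k - 1)
      else 0)"

text \<open>\<open>act\<close> is a left \<open>K[C\<^sub>n]\<close>-module structure on \<open>V\<close> that extends the given \<open>K\<close>-linear structure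
  and for which the generators act on the basis in the prescribed way.\<close>

definition chinese_module_structure ::
  "nat \<Rightarrow> nat \<Rightarrow> ('k::field \<Rightarrow> 'v::ab_group_add \<Rightarrow> 'v) \<Rightarrow> ((nat \<Rightarrow> nat) \<Rightarrow> 'v) \<Rightarrow>
   (nat \<Rightarrow> 'k) \<Rightarrow> ((nat list set \<Rightarrow> 'k) \<Rightarrow> 'v \<Rightarrow> 'v) \<Rightarrow> bool" where
  "chinese_module_structure n s scale e lam act \<longleftrightarrow>
     left_module (monoid_algebra (chinese_monoid n)) (type_module act) \<and>
     (\<forall>c v. act (alg_monom c \<one>\<^bsub>chinese_monoid n\<^esub>) v = scale c v) \<and>
     (\<forall>j\<in>{1..n}. \<forall>i\<in>multi_indices s.
        act (alg_monom 1 (chinese_gen n j)) (e i) = basis_action n s scale e lam j i)"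

end

theory Submission
  imports Defs
begin

text \<open>
  Write \<open>X\<^sub>j\<close> for the operator of \<open>a\<^sub>j\<close> with \<open>j \<le> s\<close>, which raises all entries of an index from
  position \<open>j\<close> on, and \<open>D\<^sub>m\<close> for the operator of \<open>a\<^bsub>n+1-m\<^esub>\<close> with \<open>m \<le> s\<close>, which lowers all entries
  from position \<open>m\<close> on, or gives \<open>0\<close> if one of them is \<open>0\<close>.  The \<open>X\<^sub>j\<close> commute with each other,
  and so do the \<open>D\<^sub>m\<close>; the relations of the Chinese monoid that mix the two kinds are checked on
  basis vectors, where the point is that both sides vanish for the same indices
  (\<open>chinese_relations\<close>).  A family of linear operators that satisfies the defining relations of a
  monoid extends to a module over its algebra (\<open>class_action_class\<close> and
  \<open>left_module_of_representation\<close>), and such a module is determined by the generators; this gives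
  existence and uniqueness.

  Put \<open>X\<^bsub>s+1\<^esub> = D\<^bsub>s+1\<^esub> = 1\<close>.  Up to nonzero scalars, \<open>D\<^sub>k X\<^bsub>k+1\<^esub>\<close> lowers the \<open>k\<close>-th entry alone
  and \<open>D\<^bsub>k+1\<^esub> X\<^sub>k\<close> raises it alone.  The former act like partial derivatives: a nonzero vector that
  they all kill is a multiple of the basis vector \<open>e\<^bsub>0,\<dots>,0\<^esub>\<close>, so applying them as long as possible
  shows that every nonzero submodule contains \<open>e\<^bsub>0,\<dots>,0\<^esub>\<close> (\<open>origin_in_invariant\<close>).  The latter then
  produce all other basis vectors, so that the submodule is everything (\<open>invariant_eq_UNIV\<close>).

  Finally \<open>D\<^sub>k X\<^sub>k\<close> is multiplication by \<open>\<lambda>\<^sub>k\<close> on the whole module (\<open>down_raise\<close>).  So one element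
  of the monoid acts by \<open>\<lambda>\<^sub>k\<close> on \<open>V(\<lambda>)\<close> and by \<open>\<mu>\<^sub>k\<close> on \<open>V(\<mu>)\<close>, and an isomorphism forces
  \<open>\<lambda>\<^sub>k = \<mu>\<^sub>k\<close>.
\<close>


section \<open>Presented monoids and their representations\<close>

lemma word_cong_in_lists: "(u, v) \<in> word_cong A R \<Longrightarrow> u \<in> lists A \<and> v \<in> lists A"
  by (induction rule: word_cong.induct) auto

lemma equiv_word_cong: "equiv (lists A) (word_cong A R)"
proof (rule equivI)
  show "word_cong A R \<subseteq> lists A \<times> lists A"
    using word_cong_in_lists by fast
  show "refl_on (lists A) (word_cong A R)"
    by (auto simp: refl_on_def intro: word_cong.refl)
  show "sym (word_cong A R)"
    by (auto intro: symI word_cong.sym)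
  show "trans (word_cong A R)"
    by (auto intro: transI word_cong.trans)
qed

lemma word_class_mult:
  assumes "u \<in> lists A" and "v \<in> lists A"
  shows "word_cong A R `` {u} \<otimes>\<^bsub>presented_monoid A R\<^esub> word_cong A R `` {v} =
    word_cong A R `` {u @ v}"
proof -
  let ?U = "word_cong A R `` {u}" and ?V = "word_cong A R `` {v}"
  have "word_cong A R `` {u' @ v'} = word_cong A R `` {u @ v}" if "u' \<in> ?U" "v' \<in> ?V" for u' v'
    using that by (intro equiv_class_eq[OF equiv_word_cong])
      (auto intro: word_cong.sym word_cong.append)
  then have "(\<Union>u'\<in>?U. \<Union>v'\<in>?V. word_cong A R `` {u' @ v'}) =
    (\<Union>u'\<in>?U. \<Union>v'\<in>?V. word_cong A R `` {u @ v})"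
    by (intro SUP_cong HOL.refl) simp
  moreover have "u \<in> ?U" "v \<in> ?V"
    using assms by (auto intro: word_cong.refl)
  ultimately show ?thesis
    by (auto simp: presented_monoid_def)
qed

lemma word_class_in_carrier:
  "w \<in> lists A \<Longrightarrow> word_cong A R `` {w} \<in> carrier (presented_monoid A R)"
  by (simp add: presented_monoid_def quotientI)

lemma word_classE:
  assumes "x \<in> carrier (presented_monoid A R)"
  obtains w where "w \<in> lists A" and "x = word_cong A R `` {w}"
  using assms by (auto simp: presented_monoid_def quotient_def)

lemma one_presented_monoid: "\<one>\<^bsub>presented_monoid A R\<^esub> = word_cong A R `` {[]}"
  by (simp add: presented_monoid_def)

lemma monoid_presented_monoid: "Group.monoid (presented_monoid A R)"
proof (rule monoidI)
  fix x y z
  assume "x \<in> carrier (presented_monoid A R)"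
  then obtain u where "u \<in> lists A" "x = word_cong A R `` {u}"
    by (rule word_classE)
  moreover assume "y \<in> carrier (presented_monoid A R)"
  then obtain v where "v \<in> lists A" "y = word_cong A R `` {v}"
    by (rule word_classE)
  moreover assume "z \<in> carrier (presented_monoid A R)"
  then obtain w where "w \<in> lists A" "z = word_cong A R `` {w}"
    by (rule word_classE)
  ultimately show "x \<otimes>\<^bsub>presented_monoid A R\<^esub> y \<in> carrier (presented_monoid A R)"
    and "x \<otimes>\<^bsub>presented_monoid A R\<^esub> y \<otimes>\<^bsub>presented_monoid A R\<^esub> z =
      x \<otimes>\<^bsub>presented_monoid A R\<^esub> (y \<otimes>\<^bsub>presented_monoid A R\<^esub> z)"
    by (simp_all add: word_class_mult word_class_in_carrier)
next
  fix x
  assume "x \<in> carrier (presented_monoid A R)"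
  then obtain w where "w \<in> lists A" "x = word_cong A R `` {w}"
    by (rule word_classE)
  then show "\<one>\<^bsub>presented_monoid A R\<^esub> \<otimes>\<^bsub>presented_monoid A R\<^esub> x = x"
    and "x \<otimes>\<^bsub>presented_monoid A R\<^esub> \<one>\<^bsub>presented_monoid A R\<^esub> = x"
    by (simp_all add: word_class_mult one_presented_monoid)
qed (simp add: one_presented_monoid word_class_in_carrier)

text \<open>Operators that satisfy the defining relations satisfy all their consequences, because
  equality of the operators of two words is itself a congruence.\<close>

lemma foldr_word_cong:
  assumes "\<And>u v. (u, v) \<in> R \<Longrightarrow> foldr g u = foldr g v"
  shows "(u, v) \<in> word_cong A R \<Longrightarrow> foldr g u = foldr g v"
proof (induction rule: word_cong.induct)
  case (rel u v)
  then show ?case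
    by (intro assms)
qed simp_all

text \<open>For operators that satisfy the relations, all words in a class give the same operator, so that
  any representative will do.\<close>

definition class_action :: "('a \<Rightarrow> 'v \<Rightarrow> 'v) \<Rightarrow> 'a list set \<Rightarrow> 'v \<Rightarrow> 'v" where
  "class_action g x = foldr g (SOME w. w \<in> x)"

lemma class_action_class:
  assumes "\<And>u v. (u, v) \<in> R \<Longrightarrow> foldr g u = foldr g v" and "w \<in> lists A"
  shows "class_action g (word_cong A R `` {w}) = foldr g w"
proof -
  have "w \<in> word_cong A R `` {w}"
    using assms(2) by (auto intro: word_cong.refl)
  then have "(SOME w'. w' \<in> word_cong A R `` {w}) \<in> word_cong A R `` {w}"
    by (rule someI)
  then have "(w, SOME w'. w' \<in> word_cong A R `` {w}) \<in> word_cong A R"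
    by (simp only: Image_singleton_iff)
  from foldr_word_cong[of R g, OF assms(1) this] show ?thesis
    by (simp add: class_action_def)
qed


section \<open>The ring structure of a monoid algebra\<close>

abbreviation support :: "('m \<Rightarrow> 'k::field) \<Rightarrow> 'm set" where
  "support f \<equiv> {x. f x \<noteq> 0}"

lemma monoid_algebra_carrier:
  "f \<in> carrier (monoid_algebra G) \<longleftrightarrow> finite (support f) \<and> support f \<subseteq> carrier G"
  by (simp add: monoid_algebra_def)

lemma monoid_algebra_add: "f \<oplus>\<^bsub>monoid_algebra G\<^esub> g = (\<lambda>x. f x + g x)"
  by (simp add: monoid_algebra_def)

lemma monoid_algebra_zero: "\<zero>\<^bsub>monoid_algebra G\<^esub> = (\<lambda>x. 0)"
  by (simp add: monoid_algebra_def)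

lemma monoid_algebra_one: "\<one>\<^bsub>monoid_algebra G\<^esub> = alg_monom 1 \<one>\<^bsub>G\<^esub>"
  by (auto simp: monoid_algebra_def alg_monom_def)

lemma monoid_algebra_mult_eq_sum:
  assumes "finite A" "support f \<subseteq> A" "finite B" "support g \<subseteq> B"
  shows "(f \<otimes>\<^bsub>monoid_algebra G\<^esub> g) x =
    (\<Sum>a\<in>A. \<Sum>b\<in>B. if a \<otimes>\<^bsub>G\<^esub> b = x then f a * g b else 0)"
proof -
  have "(f \<otimes>\<^bsub>monoid_algebra G\<^esub> g) x =
    (\<Sum>(a, b)\<in>{(a, b). f a \<noteq> 0 \<and> g b \<noteq> 0 \<and> a \<otimes>\<^bsub>G\<^esub> b = x}. f a * g b)"
    by (simp add: monoid_algebra_def)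
  also have "\<dots> = (\<Sum>(a, b)\<in>A \<times> B. if a \<otimes>\<^bsub>G\<^esub> b = x then f a * g b else 0)"
    using assms by (intro sum.mono_neutral_cong_left) (auto split: if_splits)
  finally show ?thesis
    by (simp add: sum.cartesian_product)
qed

text \<open>This bounds the support by a finite set that does not depend on the coefficients, over which
  sums can be exchanged even though cancellation may make the support of the product smaller.\<close>

lemma support_monoid_algebra_mult:
  "support (f \<otimes>\<^bsub>monoid_algebra G\<^esub> g) \<subseteq> (\<lambda>(a, b). a \<otimes>\<^bsub>G\<^esub> b) ` (support f \<times> support g)"
proof
  fix x
  assume "x \<in> support (f \<otimes>\<^bsub>monoid_algebra G\<^esub> g)"
  then have "(\<Sum>(a, b)\<in>{(a, b). f a \<noteq> 0 \<and> g b \<noteq> 0 \<and> a \<otimes>\<^bsub>G\<^esub> b = x}. f a * g b) \<noteq> 0"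
    by (simp add: monoid_algebra_def)
  then have "{(a, b). f a \<noteq> 0 \<and> g b \<noteq> 0 \<and> a \<otimes>\<^bsub>G\<^esub> b = x} \<noteq> {}"
    by (metis (no_types, lifting) sum.empty)
  then show "x \<in> (\<lambda>(a, b). a \<otimes>\<^bsub>G\<^esub> b) ` (support f \<times> support g)"
    by auto
qed

text \<open>Any map from the monoid to a vector space extends linearly to the monoid algebra.  Both the
  action of the algebra on a representation and, with values in the field, the coefficients of a
  product are of this form, so that the next lemmas serve for the ring axioms and for the module
  axioms alike.\<close>

definition linear_extension ::
  "('k::field \<Rightarrow> 'v::ab_group_add \<Rightarrow> 'v) \<Rightarrow> ('m \<Rightarrow> 'v) \<Rightarrow> ('m \<Rightarrow> 'k) \<Rightarrow> 'v" where
  "linear_extension scale \<phi> f = (\<Sum>x\<in>support f. scale (f x) (\<phi> x))"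

context vector_space
begin

lemma linear_extension_superset:
  assumes "finite A" "support f \<subseteq> A"
  shows "linear_extension scale \<phi> f = (\<Sum>x\<in>A. scale (f x) (\<phi> x))"
  unfolding linear_extension_def using assms by (intro sum.mono_neutral_left) auto

lemma linear_extension_add:
  assumes "finite (support f)" "finite (support g)"
  shows "linear_extension scale \<phi> (\<lambda>x. f x + g x) =
    linear_extension scale \<phi> f + linear_extension scale \<phi> g"
proof -
  let ?A = "support f \<union> support g"
  have "finite ?A" "support f \<subseteq> ?A" "support g \<subseteq> ?A" "support (\<lambda>x. f x + g x) \<subseteq> ?A"
    using assms by auto
  then show ?thesis
    by (simp add: linear_extension_superset[of ?A] scale_left_distrib sum.distrib)
qed

lemma linear_extension_monom: "linear_extension scale \<phi> (alg_monom c a) = scale c (\<phi> a)"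
proof -
  have "linear_extension scale \<phi> (alg_monom c a) = (\<Sum>x\<in>{a}. scale (alg_monom c a x) (\<phi> x))"
    by (rule linear_extension_superset) (auto simp: alg_monom_def)
  then show ?thesis
    by (simp add: alg_monom_def)
qed

lemma linear_extension_mult:
  assumes "finite (support f)" "finite (support g)"
  shows "linear_extension scale \<phi> (f \<otimes>\<^bsub>monoid_algebra G\<^esub> g) =
    (\<Sum>a\<in>support f. \<Sum>b\<in>support g. scale (f a * g b) (\<phi> (a \<otimes>\<^bsub>G\<^esub> b)))"
proof -
  let ?P = "(\<lambda>(a, b). a \<otimes>\<^bsub>G\<^esub> b) ` (support f \<times> support g)"
  have fin: "finite ?P"
    using assms by simp
  have "linear_extension scale \<phi> (f \<otimes>\<^bsub>monoid_algebra G\<^esub> g) =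
    (\<Sum>x\<in>?P. scale ((f \<otimes>\<^bsub>monoid_algebra G\<^esub> g) x) (\<phi> x))"
    by (rule linear_extension_superset[OF fin support_monoid_algebra_mult])
  also have "\<dots> = (\<Sum>x\<in>?P. \<Sum>a\<in>support f. \<Sum>b\<in>support g.
      scale (if a \<otimes>\<^bsub>G\<^esub> b = x then f a * g b else 0) (\<phi> x))"
    by (simp add: monoid_algebra_mult_eq_sum[OF assms(1) order_refl assms(2) order_refl]
        scale_sum_left)
  also have "\<dots> = (\<Sum>a\<in>support f. \<Sum>x\<in>?P. \<Sum>b\<in>support g.
      scale (if a \<otimes>\<^bsub>G\<^esub> b = x then f a * g b else 0) (\<phi> x))"
    by (rule sum.swap)
  also have "\<dots> = (\<Sum>a\<in>support f. \<Sum>b\<in>support g. \<Sum>x\<in>?P.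
      scale (if a \<otimes>\<^bsub>G\<^esub> b = x then f a * g b else 0) (\<phi> x))"
    by (intro sum.cong[OF HOL.refl] sum.swap)
  also have "\<dots> = (\<Sum>a\<in>support f. \<Sum>b\<in>support g. scale (f a * g b) (\<phi> (a \<otimes>\<^bsub>G\<^esub> b)))"
  proof (intro sum.cong HOL.refl)
    fix a b
    assume "a \<in> support f" "b \<in> support g"
    then have "a \<otimes>\<^bsub>G\<^esub> b \<in> ?P"
      by auto
    then have "(\<Sum>x\<in>?P. if a \<otimes>\<^bsub>G\<^esub> b = x then scale (f a * g b) (\<phi> x) else 0) =
      scale (f a * g b) (\<phi> (a \<otimes>\<^bsub>G\<^esub> b))"
      using fin by (subst sum.delta') auto
    then show "(\<Sum>x\<in>?P. scale (if a \<otimes>\<^bsub>G\<^esub> b = x then f a * g b else 0) (\<phi> x)) =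
      scale (f a * g b) (\<phi> (a \<otimes>\<^bsub>G\<^esub> b))"
      by (simp add: if_distrib[of "\<lambda>c. scale c _"] cong: if_cong)
  qed
  finally show ?thesis .
qed

end

lemma vector_space_field: "vector_space ((*) :: 'k::field \<Rightarrow> 'k \<Rightarrow> 'k)"
  by unfold_locales (simp_all add: algebra_simps)

lemma monoid_algebra_mult_eq_left:
  assumes "finite (support f)" "finite (support g)"
  shows "(f \<otimes>\<^bsub>monoid_algebra G\<^esub> g) x =
    linear_extension (*) (\<lambda>a. \<Sum>b\<in>support g. if a \<otimes>\<^bsub>G\<^esub> b = x then g b else 0) f"
  unfolding linear_extension_def
  by (subst monoid_algebra_mult_eq_sum[OF assms(1) order_refl assms(2) order_refl])
    (simp add: sum_distrib_left if_distrib[of "\<lambda>c. _ * c"] cong: if_cong)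

lemma monoid_algebra_mult_eq_right:
  assumes "finite (support f)" "finite (support g)"
  shows "(f \<otimes>\<^bsub>monoid_algebra G\<^esub> g) x =
    (\<Sum>a\<in>support f. f a * linear_extension (*) (\<lambda>b. if a \<otimes>\<^bsub>G\<^esub> b = x then 1 else 0) g)"
  unfolding linear_extension_def
  by (subst monoid_algebra_mult_eq_sum[OF assms(1) order_refl assms(2) order_refl])
    (simp add: sum_distrib_left if_distrib[of "\<lambda>c. _ * c"] cong: if_cong)

lemma monoid_algebra_mult_closed:
  assumes "Group.monoid G" "f \<in> carrier (monoid_algebra G)" "g \<in> carrier (monoid_algebra G)"
  shows "f \<otimes>\<^bsub>monoid_algebra G\<^esub> g \<in> carrier (monoid_algebra G)"
proof -
  interpret G: Group.monoid G by fact
  have "finite ((\<lambda>(a, b). a \<otimes>\<^bsub>G\<^esub> b) ` (support f \<times> support g))"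
    "(\<lambda>(a, b). a \<otimes>\<^bsub>G\<^esub> b) ` (support f \<times> support g) \<subseteq> carrier G"
    using assms(2,3) by (auto simp: monoid_algebra_carrier)
  then show ?thesis
    unfolding monoid_algebra_carrier using support_monoid_algebra_mult[of G f g]
    by (blast intro: finite_subset)
qed

lemma alg_monom_in_carrier: "a \<in> carrier G \<Longrightarrow> alg_monom c a \<in> carrier (monoid_algebra G)"
  by (auto simp: monoid_algebra_carrier alg_monom_def)

lemma alg_monom_mult:
  "alg_monom c a \<otimes>\<^bsub>monoid_algebra G\<^esub> alg_monom d b = alg_monom (c * d) (a \<otimes>\<^bsub>G\<^esub> b)"
proof
  fix x
  show "(alg_monom c a \<otimes>\<^bsub>monoid_algebra G\<^esub> alg_monom d b) x = alg_monom (c * d) (a \<otimes>\<^bsub>G\<^esub> b) x"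
    by (subst monoid_algebra_mult_eq_sum[of "{a}" _ "{b}"]) (auto simp: alg_monom_def)
qed

text \<open>Read as a linear extension in its left factor, the coefficient of \<open>(f g) h\<close> at \<open>x\<close> becomes the
  sum of \<open>f a \<cdot> g b \<cdot> h c\<close> over all triples with \<open>(a b) c = x\<close>; read as one in its right
  factor, the coefficient of \<open>f (g h)\<close> becomes the same sum over \<open>a (b c) = x\<close>.\<close>

lemma monoid_algebra_assoc:
  fixes f g h :: "'m \<Rightarrow> 'k::field"
  assumes "Group.monoid G" "f \<in> carrier (monoid_algebra G)" "g \<in> carrier (monoid_algebra G)"
    "h \<in> carrier (monoid_algebra G)"
  shows "f \<otimes>\<^bsub>monoid_algebra G\<^esub> g \<otimes>\<^bsub>monoid_algebra G\<^esub> h =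
    f \<otimes>\<^bsub>monoid_algebra G\<^esub> (g \<otimes>\<^bsub>monoid_algebra G\<^esub> h)"
proof
  fix x
  interpret G: Group.monoid G by fact
  have fin: "finite (support f)" "finite (support g)" "finite (support h)"
    and sub: "support f \<subseteq> carrier G" "support g \<subseteq> carrier G" "support h \<subseteq> carrier G"
    using assms(2-4) by (auto simp: monoid_algebra_carrier)
  have fin2: "finite (support (f \<otimes>\<^bsub>monoid_algebra G\<^esub> g))" "finite (support (g \<otimes>\<^bsub>monoid_algebra G\<^esub> h))"
    using monoid_algebra_mult_closed assms by (metis monoid_algebra_carrier)+
  have "(f \<otimes>\<^bsub>monoid_algebra G\<^esub> g \<otimes>\<^bsub>monoid_algebra G\<^esub> h) x =
    (\<Sum>a\<in>support f. \<Sum>b\<in>support g. f a * g b *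
      (\<Sum>c\<in>support h. if a \<otimes>\<^bsub>G\<^esub> b \<otimes>\<^bsub>G\<^esub> c = x then h c else 0))"
    by (simp only: monoid_algebra_mult_eq_left[OF fin2(1) fin(3)]
        vector_space.linear_extension_mult[OF vector_space_field fin(1,2)])
  also have "\<dots> = (\<Sum>a\<in>support f. \<Sum>b\<in>support g. \<Sum>c\<in>support h.
      if a \<otimes>\<^bsub>G\<^esub> b \<otimes>\<^bsub>G\<^esub> c = x then f a * (g b * h c) else 0)"
    by (intro sum.cong HOL.refl) (auto simp: sum_distrib_left mult.assoc intro!: sum.cong)
  also have "\<dots> = (\<Sum>a\<in>support f. \<Sum>b\<in>support g. \<Sum>c\<in>support h.
      if a \<otimes>\<^bsub>G\<^esub> (b \<otimes>\<^bsub>G\<^esub> c) = x then f a * (g b * h c) else 0)"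
    using sub by (intro sum.cong HOL.refl) (auto simp: G.m_assoc subset_iff)
  also have "\<dots> = (\<Sum>a\<in>support f. f a * (\<Sum>b\<in>support g. \<Sum>c\<in>support h.
      g b * h c * (if a \<otimes>\<^bsub>G\<^esub> (b \<otimes>\<^bsub>G\<^esub> c) = x then 1 else 0)))"
    by (auto simp: sum_distrib_left mult.assoc intro!: sum.cong)
  also have "\<dots> = (f \<otimes>\<^bsub>monoid_algebra G\<^esub> (g \<otimes>\<^bsub>monoid_algebra G\<^esub> h)) x"
    by (simp only: monoid_algebra_mult_eq_right[OF fin(1) fin2(2)]
        vector_space.linear_extension_mult[OF vector_space_field fin(2,3)])
  finally show "(f \<otimes>\<^bsub>monoid_algebra G\<^esub> g \<otimes>\<^bsub>monoid_algebra G\<^esub> h) x =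
    (f \<otimes>\<^bsub>monoid_algebra G\<^esub> (g \<otimes>\<^bsub>monoid_algebra G\<^esub> h)) x" .
qed

lemma monoid_algebra_add_closed:
  assumes "f \<in> carrier (monoid_algebra G)" "g \<in> carrier (monoid_algebra G)"
  shows "f \<oplus>\<^bsub>monoid_algebra G\<^esub> g \<in> carrier (monoid_algebra G)"
proof -
  have "support (\<lambda>x. f x + g x) \<subseteq> support f \<union> support g"
    by auto
  moreover have "finite (support f \<union> support g)" "support f \<union> support g \<subseteq> carrier G"
    using assms by (auto simp: monoid_algebra_carrier)
  ultimately show ?thesis
    unfolding monoid_algebra_carrier monoid_algebra_add by (meson finite_subset order_trans)
qed

lemma ring_monoid_algebra:
  fixes G :: "('m, 'r) monoid_scheme"
  assumes "Group.monoid G"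
  shows "Ring.ring (monoid_algebra G :: ('m \<Rightarrow> 'k::field) ring)"
proof (rule ringI)
  let ?R = "monoid_algebra G :: ('m \<Rightarrow> 'k) ring"
  interpret G: Group.monoid G by fact
  show "abelian_group ?R"
  proof (rule abelian_groupI)
    fix f :: "'m \<Rightarrow> 'k"
    assume "f \<in> carrier ?R"
    then have "(\<lambda>x. - f x) \<in> carrier ?R" "(\<lambda>x. - f x) \<oplus>\<^bsub>?R\<^esub> f = \<zero>\<^bsub>?R\<^esub>"
      by (simp_all add: monoid_algebra_carrier monoid_algebra_add monoid_algebra_zero)
    then show "\<exists>g\<in>carrier ?R. g \<oplus>\<^bsub>?R\<^esub> f = \<zero>\<^bsub>?R\<^esub>"
      by blast
  qed (simp_all only: monoid_algebra_add_closed,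
      simp_all add: monoid_algebra_carrier monoid_algebra_add monoid_algebra_zero algebra_simps)
  show "Group.monoid ?R"
  proof (rule monoidI)
    show "\<one>\<^bsub>?R\<^esub> \<in> carrier ?R"
      by (simp add: monoid_algebra_one alg_monom_in_carrier)
    fix f :: "'m \<Rightarrow> 'k"
    assume f: "f \<in> carrier ?R"
    then have fin: "finite (support f)" and sub: "support f \<subseteq> carrier G"
      by (simp_all add: monoid_algebra_carrier)
    have one: "finite {\<one>\<^bsub>G\<^esub>}" "support (alg_monom (1::'k) \<one>\<^bsub>G\<^esub>) \<subseteq> {\<one>\<^bsub>G\<^esub>}"
      by (auto simp: alg_monom_def)
    have delta: "(\<Sum>a\<in>support f. if a = x then f a else 0) = f x" for x
      using fin by (auto simp: sum.delta)
    show "\<one>\<^bsub>?R\<^esub> \<otimes>\<^bsub>?R\<^esub> f = f"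
    proof
      fix x
      have "(\<one>\<^bsub>?R\<^esub> \<otimes>\<^bsub>?R\<^esub> f) x = (\<Sum>a\<in>support f. if \<one>\<^bsub>G\<^esub> \<otimes>\<^bsub>G\<^esub> a = x then f a else 0)"
        unfolding monoid_algebra_one
        by (subst monoid_algebra_mult_eq_sum[OF one fin order_refl]) (simp add: alg_monom_def cong: if_cong)
      also have "\<dots> = (\<Sum>a\<in>support f. if a = x then f a else 0)"
        using sub by (intro sum.cong HOL.refl) (auto simp: subset_iff)
      finally show "(\<one>\<^bsub>?R\<^esub> \<otimes>\<^bsub>?R\<^esub> f) x = f x"
        by (simp only: delta)
    qed
    show "f \<otimes>\<^bsub>?R\<^esub> \<one>\<^bsub>?R\<^esub> = f"
    proof
      fix x
      have "(f \<otimes>\<^bsub>?R\<^esub> \<one>\<^bsub>?R\<^esub>) x = (\<Sum>a\<in>support f. if a \<otimes>\<^bsub>G\<^esub> \<one>\<^bsub>G\<^esub> = x then f a else 0)"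
        unfolding monoid_algebra_one
        by (subst monoid_algebra_mult_eq_sum[OF fin order_refl one]) (simp add: alg_monom_def cong: if_cong)
      also have "\<dots> = (\<Sum>a\<in>support f. if a = x then f a else 0)"
        using sub by (intro sum.cong HOL.refl) (auto simp: subset_iff)
      finally show "(f \<otimes>\<^bsub>?R\<^esub> \<one>\<^bsub>?R\<^esub>) x = f x"
        by (simp only: delta)
    qed
  qed (use assms in \<open>simp_all add: monoid_algebra_mult_closed monoid_algebra_assoc\<close>)
  fix f g h :: "'m \<Rightarrow> 'k"
  assume fgh: "f \<in> carrier ?R" "g \<in> carrier ?R" "h \<in> carrier ?R"
  then have fin: "finite (support f)" "finite (support g)" "finite (support h)"
    by (simp_all add: monoid_algebra_carrier)
  have fin2: "finite (support (\<lambda>x. f x + g x))"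
    using monoid_algebra_add_closed[OF fgh(1,2)]
    by (simp add: monoid_algebra_carrier monoid_algebra_add)
  show "(f \<oplus>\<^bsub>?R\<^esub> g) \<otimes>\<^bsub>?R\<^esub> h = f \<otimes>\<^bsub>?R\<^esub> h \<oplus>\<^bsub>?R\<^esub> g \<otimes>\<^bsub>?R\<^esub> h"
    unfolding monoid_algebra_add
    by (rule ext)
      (simp only: monoid_algebra_mult_eq_left fin fin2 vector_space.linear_extension_add[OF vector_space_field])
  show "h \<otimes>\<^bsub>?R\<^esub> (f \<oplus>\<^bsub>?R\<^esub> g) = h \<otimes>\<^bsub>?R\<^esub> f \<oplus>\<^bsub>?R\<^esub> h \<otimes>\<^bsub>?R\<^esub> g"
    unfolding monoid_algebra_add
    by (rule ext)
      (simp only: monoid_algebra_mult_eq_right fin fin2 vector_space.linear_extension_add[OF vector_space_field]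
        distrib_left sum.distrib)
qed

section \<open>Representations of a monoid as modules over its algebra\<close>

text \<open>Compatibility with the product of the algebra is \<open>linear_extension_mult\<close>: the linear operator \<open>\<rho> a\<close>
  moves inside the sum over the support of the second factor.\<close>

lemma left_module_of_representation:
  fixes scale :: "'k::field \<Rightarrow> 'v::ab_group_add \<Rightarrow> 'v" and G :: "('m, 'r) monoid_scheme"
  assumes "Group.monoid G" and "vector_space scale"
    and lin: "\<And>x. x \<in> carrier G \<Longrightarrow> Vector_Spaces.linear scale scale (\<rho> x)"
    and mult: "\<And>x y v. x \<in> carrier G \<Longrightarrow> y \<in> carrier G \<Longrightarrow> \<rho> (x \<otimes>\<^bsub>G\<^esub> y) v = \<rho> x (\<rho> y v)"
    and one: "\<And>v. \<rho> \<one>\<^bsub>G\<^esub> v = v"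
  shows "left_module (monoid_algebra G)
    (type_module (\<lambda>f v. linear_extension scale (\<lambda>x. \<rho> x v) f))"
proof -
  interpret vector_space scale by fact
  interpret R: ring "monoid_algebra G :: ('m \<Rightarrow> 'k) ring"
    using assms(1) by (rule ring_monoid_algebra)
  let ?act = "\<lambda>f v. linear_extension scale (\<lambda>x. \<rho> x v) f"
  let ?M = "type_module ?act"
  note carrierD = monoid_algebra_carrier[THEN iffD1]
  have grp: "abelian_group ?M"
    by (rule abelian_groupI)
      (auto simp: type_module_def algebra_simps intro: exI[of _ "- _"])
  have assoc: "?act (f \<otimes>\<^bsub>monoid_algebra G\<^esub> g) v = ?act f (?act g v)"
    if f: "f \<in> carrier (monoid_algebra G)" and g: "g \<in> carrier (monoid_algebra G)"
    for f g :: "'m \<Rightarrow> 'k" and v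
  proof -
    have "?act (f \<otimes>\<^bsub>monoid_algebra G\<^esub> g) v =
      (\<Sum>a\<in>support f. \<Sum>b\<in>support g. scale (f a * g b) (\<rho> (a \<otimes>\<^bsub>G\<^esub> b) v))"
      using f g by (intro linear_extension_mult) (auto dest: carrierD)
    also have "\<dots> = (\<Sum>a\<in>support f. scale (f a) (\<rho> a (\<Sum>b\<in>support g. scale (g b) (\<rho> b v))))"
    proof (intro sum.cong HOL.refl)
      fix a
      assume "a \<in> support f"
      then have a: "a \<in> carrier G"
        using carrierD[OF f] by auto
      interpret A: Vector_Spaces.linear scale scale "\<rho> a"
        using a by (rule lin)
      have "b \<in> carrier G" if "b \<in> support g" for b
        using carrierD[OF g] that by auto
      then show "(\<Sum>b\<in>support g. scale (f a * g b) (\<rho> (a \<otimes>\<^bsub>G\<^esub> b) v)) =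
        scale (f a) (\<rho> a (\<Sum>b\<in>support g. scale (g b) (\<rho> b v)))"
        by (simp add: A.sum A.scale scale_sum_right mult a)
    qed
    finally show ?thesis
      by (simp add: linear_extension_def)
  qed
  have add: "?act f (v + w) = ?act f v + ?act f w"
    if f: "f \<in> carrier (monoid_algebra G)" for f :: "'m \<Rightarrow> 'k" and v w
  proof -
    have "\<rho> a (v + w) = \<rho> a v + \<rho> a w" if "a \<in> support f" for a
    proof -
      have "a \<in> carrier G"
        using that carrierD[OF f] by auto
      then interpret A: Vector_Spaces.linear scale scale "\<rho> a"
        by (rule lin)
      show ?thesis
        by (rule A.add)
    qed
    then show ?thesis
      by (simp add: linear_extension_def scale_right_distrib sum.distrib)
  qed
  show ?thesis
  proof (intro left_module.intro left_module_axioms.intro)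
    show "abelian_group ?M" "ring (monoid_algebra G :: ('m \<Rightarrow> 'k) ring)"
      by (fact grp R.ring_axioms)+
  qed (simp_all add: type_module_def assoc add monoid_algebra_add linear_extension_add carrierD
      monoid_algebra_one linear_extension_monom one)
qed


section \<open>Coordinates with respect to an indexed basis\<close>

text \<open>Coordinates are labelled by the indices, not by the basis vectors themselves, so that
  statements about shifting an index can be read off directly.\<close>

locale indexed_basis = vector_space scale
  for scale :: "'k::field \<Rightarrow> 'v::ab_group_add \<Rightarrow> 'v" +
  fixes I :: "'i set" and e :: "'i \<Rightarrow> 'v"
  assumes basis_family: "basis_family scale I e"
begin

lemma inj_basis: "inj_on e I"
  and independent_basis: "independent (e ` I)"
  and span_basis: "span (e ` I) = UNIV"
  using basis_family by (simp_all add: basis_family_def)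

lemma linear_eq_on_basis:
  assumes "Vector_Spaces.linear scale scale' f" "Vector_Spaces.linear scale scale' f'"
    and "\<And>i. i \<in> I \<Longrightarrow> f (e i) = f' (e i)"
  shows "f v = f' v"
proof -
  interpret f: Vector_Spaces.linear scale scale' f by fact
  interpret P: vector_space_pair scale scale' ..
  show ?thesis
    by (rule P.linear_eq_on[OF assms(1,2), of v "e ` I"]) (auto simp: span_basis assms(3))
qed

lemma linear_map_exists: "\<exists>f. Vector_Spaces.linear scale scale f \<and> (\<forall>i\<in>I. f (e i) = h i)"
proof -
  interpret P: vector_space_pair scale scale ..
  obtain f where "Vector_Spaces.linear scale scale f" "\<forall>x\<in>e ` I. f x = h (inv_into I e x)"
    using P.linear_independent_extend[OF independent_basis, of "\<lambda>x. h (inv_into I e x)"] by blast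
  moreover from this(2) have "\<forall>i\<in>I. f (e i) = h i"
    by (simp add: inv_into_f_f[OF inj_basis])
  ultimately show ?thesis
    by blast
qed

definition coord :: "'v \<Rightarrow> 'i \<Rightarrow> 'k" where
  "coord v i = representation (e ` I) v (e i)"

lemma linear_coord: "Vector_Spaces.linear scale (*) (\<lambda>v. coord v i)"
  unfolding coord_def by (rule linear_representation[OF independent_basis span_basis])

lemma coord_basis: "i \<in> I \<Longrightarrow> j \<in> I \<Longrightarrow> coord (e j) i = (if i = j then 1 else 0)"
  using inj_basis by (simp add: coord_def representation_basis[OF independent_basis] inj_on_eq_iff)

lemma coord_scale: "coord (scale c v) i = c * coord v i"
  by (simp add: coord_def representation_scale[OF independent_basis] span_basis)

lemma coord_zero: "coord 0 i = 0"
  by (simp add: coord_def representation_zero)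

lemma finite_coord: "finite {i\<in>I. coord v i \<noteq> 0}"
proof (rule finite_imageD)
  show "finite (e ` {i\<in>I. coord v i \<noteq> 0})"
    by (rule finite_subset[OF _ finite_representation[of "e ` I" v]]) (auto simp: coord_def)
  show "inj_on e {i\<in>I. coord v i \<noteq> 0}"
    by (rule inj_on_subset[OF inj_basis]) auto
qed

lemma eq_if_coord_eq:
  assumes "\<And>i. i \<in> I \<Longrightarrow> coord v i = coord w i"
  shows "v = w"
proof -
  have "representation (e ` I) v b = representation (e ` I) w b" for b
  proof (cases "b \<in> e ` I")
    case True
    then show ?thesis
      using assms by (auto simp: coord_def)
  next
    case False
    then have "representation (e ` I) u b = 0" for u
      using representation_ne_zero[of "e ` I" u b] by blast
    then show ?thesis
      by simp
  qed
  then have eq: "representation (e ` I) v = representation (e ` I) w"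
    by (rule ext)
  have sum_eq: "(\<Sum>b | representation (e ` I) u b \<noteq> 0. scale (representation (e ` I) u b) b) = u" for u
    by (rule sum_nonzero_representation_eq[OF independent_basis]) (simp add: span_basis)
  show ?thesis
    using sum_eq[of v] sum_eq[of w] unfolding eq by (rule HOL.trans[OF HOL.sym])
qed

lemma basis_nonzero: "i \<in> I \<Longrightarrow> e i \<noteq> 0"
  using coord_basis[of i i] coord_zero[of i] by auto

end


section \<open>The operators of the generators\<close>

definition raise_from :: "nat \<Rightarrow> nat \<Rightarrow> (nat \<Rightarrow> nat) \<Rightarrow> nat \<Rightarrow> nat" where
  "raise_from s j i = (\<lambda>k\<in>{1..s}. if k < j then i k else i k + 1)"

definition lower_from :: "nat \<Rightarrow> nat \<Rightarrow> (nat \<Rightarrow> nat) \<Rightarrow> nat \<Rightarrow> nat" where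
  "lower_from s m i = (\<lambda>k\<in>{1..s}. if k < m then i k else i k - 1)"

definition lowerable :: "nat \<Rightarrow> nat \<Rightarrow> (nat \<Rightarrow> nat) \<Rightarrow> bool" where
  "lowerable s m i \<longleftrightarrow> (\<forall>k\<in>{1..s}. m \<le> k \<longrightarrow> i k > 0)"

lemma raise_from_in [simp]: "raise_from s j i \<in> multi_indices s"
  and lower_from_in [simp]: "lower_from s m i \<in> multi_indices s"
  by (simp_all add: raise_from_def lower_from_def multi_indices_def)

lemma raise_from_apply [simp]:
    "k \<in> {1..s} \<Longrightarrow> raise_from s j i k = (if k < j then i k else i k + 1)"
  and lower_from_apply [simp]:
    "k \<in> {1..s} \<Longrightarrow> lower_from s m i k = (if k < m then i k else i k - 1)"
  by (simp_all add: raise_from_def lower_from_def)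

lemma multi_indices_eqI:
  assumes "i \<in> multi_indices s" "i' \<in> multi_indices s" "\<And>k. k \<in> {1..s} \<Longrightarrow> i k = i' k"
  shows "i = i'"
  using assms unfolding multi_indices_def by (rule PiE_ext)

lemma multi_indices_update:
  "i \<in> multi_indices s \<Longrightarrow> k \<in> {1..s} \<Longrightarrow> i(k := x) \<in> multi_indices s"
  by (auto simp: multi_indices_def PiE_def extensional_def)

locale chinese_operators = indexed_basis scale "multi_indices s" e
  for scale :: "'k::field \<Rightarrow> 'v::ab_group_add \<Rightarrow> 'v" and s e +
  fixes lam :: "nat \<Rightarrow> 'k" and g :: "nat \<Rightarrow> 'v \<Rightarrow> 'v"
  assumes linear_g: "j \<in> {1..2 * s} \<Longrightarrow> Vector_Spaces.linear scale scale (g j)"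
    and g_basis: "j \<in> {1..2 * s} \<Longrightarrow> i \<in> multi_indices s \<Longrightarrow>
      g j (e i) = basis_action (2 * s) s scale e lam j i"
begin

text \<open>The generators beyond \<open>s\<close> are renamed by the first position that they lower.  Then the
  operator \<open>down m\<close> undoes \<open>g m\<close> up to a scalar.\<close>

definition down :: "nat \<Rightarrow> 'v \<Rightarrow> 'v" where
  "down m = g (2 * s + 1 - m)"

lemma g_scale: "j \<in> {1..2 * s} \<Longrightarrow> g j (scale c v) = scale c (g j v)"
  and g_zero: "j \<in> {1..2 * s} \<Longrightarrow> g j 0 = 0"
proof -
  assume "j \<in> {1..2 * s}"
  then interpret G: Vector_Spaces.linear scale scale "g j"
    by (rule linear_g)
  show "g j (scale c v) = scale c (g j v)" "g j 0 = 0"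
    by (simp_all add: G.scale G.zero)
qed

lemma linear_down: "m \<in> {1..s} \<Longrightarrow> Vector_Spaces.linear scale scale (down m)"
  unfolding down_def by (intro linear_g) auto

lemma down_scale: "m \<in> {1..s} \<Longrightarrow> down m (scale c v) = scale c (down m v)"
  and down_zero: "m \<in> {1..s} \<Longrightarrow> down m 0 = 0"
  unfolding down_def by (rule g_scale g_zero; simp; linarith)+

lemma g_raise:
  assumes "j \<in> {1..s}" "i \<in> multi_indices s"
  shows "g j (e i) = scale (lam j) (e (raise_from s j i))"
  using assms by (simp add: g_basis basis_action_def raise_from_def)

lemma down_lower:
  assumes m: "m \<in> {1..s}" and i: "i \<in> multi_indices s"
  shows "down m (e i) = (if lowerable s m i then e (lower_from s m i) else 0)"
proof -
  have "2 * s - (2 * s + 1 - m) + 1 = m" "\<not> 2 * s + 1 - m \<le> s" "2 * s + 1 - m \<in> {1..2 * s}"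
    using m by auto
  moreover have "k \<le> 2 * s - (2 * s + 1 - m) \<longleftrightarrow> k < m" for k
    using m by auto
  moreover have "(\<forall>k\<in>{m..s}. i k > 0) \<longleftrightarrow> lowerable s m i"
    using m by (auto simp: lowerable_def)
  ultimately show ?thesis
    unfolding down_def by (simp only: g_basis[OF _ i] basis_action_def lower_from_def if_False)
qed

lemma linear_comp:
  assumes "Vector_Spaces.linear scale scale f" "Vector_Spaces.linear scale scale f'"
  shows "Vector_Spaces.linear scale scale (\<lambda>v. f (f' v))"
  using Vector_Spaces.linear_compose[OF assms(2,1)] by (simp add: o_def)

lemma g_in_range: "j \<in> {1..s} \<Longrightarrow> j \<in> {1..2 * s}"
  by auto

lemmas operator_simps = g_raise down_lower g_scale[OF g_in_range] down_scale g_zero[OF g_in_range]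
  down_zero

lemma raise_commute:
  assumes "j \<in> {1..s}" "k \<in> {1..s}"
  shows "g j (g k v) = g k (g j v)"
proof (rule linear_eq_on_basis[where f = "\<lambda>v. g j (g k v)"])
  fix i
  assume "i \<in> multi_indices s"
  moreover have "raise_from s j (raise_from s k i) = raise_from s k (raise_from s j i)"
    by (rule multi_indices_eqI[where s = s]) auto
  ultimately show "g j (g k (e i)) = g k (g j (e i))"
    using assms by (simp add: operator_simps mult.commute)
qed (use assms in \<open>auto intro!: linear_comp[OF linear_g linear_g]\<close>)

lemma down_commute:
  assumes "l \<in> {1..s}" "m \<in> {1..s}"
  shows "down l (down m v) = down m (down l v)"
proof (rule linear_eq_on_basis[where f = "\<lambda>v. down l (down m v)"])
  fix i
  assume i: "i \<in> multi_indices s"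
  have "lower_from s l (lower_from s m i) = lower_from s m (lower_from s l i)"
    by (rule multi_indices_eqI[where s = s]) auto
  moreover have "lowerable s m i \<and> lowerable s l (lower_from s m i) \<longleftrightarrow>
    lowerable s l i \<and> lowerable s m (lower_from s l i)"
    unfolding lowerable_def ball_conj_distrib[symmetric] by (intro ball_cong HOL.refl) auto
  ultimately show "down l (down m (e i)) = down m (down l (e i))"
    using assms i by (auto simp: operator_simps)
qed (use assms in \<open>auto intro!: linear_comp[OF linear_down linear_down]\<close>)

text \<open>Only this case and the next use the order of the indices in the defining relations.  Here
  \<open>g i\<close> has already made every entry from position \<open>i\<close> on positive; raising the entries from
  \<open>j \<ge> i\<close> on therefore cannot change whether \<open>down m\<close> is defined or truncated to zero.\<close>

lemma raise_down_raise:
  assumes "i \<in> {1..s}" "j \<in> {1..s}" "m \<in> {1..s}" "i \<le> j"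
  shows "g j (down m (g i v)) = down m (g j (g i v))"
proof (rule linear_eq_on_basis[where f = "\<lambda>v. g j (down m (g i v))"])
  fix x
  assume x: "x \<in> multi_indices s"
  have "raise_from s j (lower_from s m (raise_from s i x)) =
    lower_from s m (raise_from s j (raise_from s i x))"
    if "lowerable s m (raise_from s i x)"
    using that by (intro multi_indices_eqI[where s = s]) (auto simp: lowerable_def)
  moreover have "lowerable s m (raise_from s i x) \<longleftrightarrow>
    lowerable s m (raise_from s j (raise_from s i x))"
    unfolding lowerable_def using \<open>i \<le> j\<close> by (intro ball_cong HOL.refl) auto
  ultimately show "g j (down m (g i (e x))) = down m (g j (g i (e x)))"
    using assms x by (simp add: operator_simps)
qed (use assms in \<open>auto intro!: linear_comp[OF linear_g linear_comp[OF linear_down linear_g]]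
      linear_comp[OF linear_down linear_comp[OF linear_g linear_g]]\<close>)

text \<open>Because \<open>m \<le> l\<close>, every entry lowered by \<open>down l\<close> is also lowered by \<open>down m\<close>.  An entry from
  position \<open>l\<close> on that \<open>g i\<close> raises must be at least 1 for either side to survive, and one that it
  does not raise must be at least 2; when the raise happens makes no difference.\<close>

lemma down_raise_down:
  assumes "i \<in> {1..s}" "l \<in> {1..s}" "m \<in> {1..s}" "m \<le> l"
  shows "down m (g i (down l v)) = down m (down l (g i v))"
proof (rule linear_eq_on_basis[where f = "\<lambda>v. down m (g i (down l v))"])
  fix x
  assume x: "x \<in> multi_indices s"
  have "lower_from s m (raise_from s i (lower_from s l x)) =
    lower_from s m (lower_from s l (raise_from s i x))"
    if "lowerable s l x"
    using that by (intro multi_indices_eqI[where s = s]) (auto simp: lowerable_def)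
  moreover have "lowerable s l x \<and> lowerable s m (raise_from s i (lower_from s l x)) \<longleftrightarrow>
    lowerable s l (raise_from s i x) \<and> lowerable s m (lower_from s l (raise_from s i x))"
    unfolding lowerable_def ball_conj_distrib[symmetric]
    using \<open>m \<le> l\<close> by (intro ball_cong HOL.refl) auto
  ultimately show "down m (g i (down l (e x))) = down m (down l (g i (e x)))"
    using assms x by (auto simp: operator_simps)
qed (use assms in \<open>auto intro!: linear_comp[OF linear_down linear_comp[OF linear_g linear_down]]
      linear_comp[OF linear_down linear_comp[OF linear_down linear_g]]\<close>)

text \<open>Write \<open>i \<le> j \<le> k\<close>.  If all three indices lie on the same side of \<open>s\<close>, the relations are
  commutation relations.  If \<open>s\<close> lies between \<open>j\<close> and \<open>k\<close> or between \<open>i\<close> and \<open>j\<close>, one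
  of the two is a commutation relation and the other is \<open>raise_down_raise\<close> or \<open>down_raise_down\<close>.\<close>

lemma chinese_relations:
  assumes "(u, v) \<in> chinese_rels (2 * s)"
  shows "foldr g u = foldr g v"
proof -
  from assms obtain i j k where ijk: "1 \<le> i" "i \<le> j" "j \<le> k" "k \<le> 2 * s"
    and uv: "u = [j, k, i] \<and> v = [k, j, i] \<or> u = [k, j, i] \<and> v = [k, i, j]"
    by (auto simp: chinese_rels_def)
  define m where "m = 2 * s + 1 - k"
  define l where "l = 2 * s + 1 - j"
  define q where "q = 2 * s + 1 - i"
  have down_m: "down m = g k" and down_l: "down l = g j" and down_q: "down q = g i"
    using ijk by (auto simp: m_def l_def q_def down_def)
  have "g j (g k (g i w)) = g k (g j (g i w)) \<and> g k (g j (g i w)) = g k (g i (g j w))" for w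
  proof -
    consider "k \<le> s" | "j \<le> s" "s < k" | "i \<le> s" "s < j" | "s < i"
      using ijk by linarith
    then show ?thesis
    proof cases
      case 1
      then show ?thesis
        using ijk by (simp add: raise_commute[of j k] raise_commute[of j i])
    next
      case 2
      then have "m \<in> {1..s}"
        using ijk by (auto simp: m_def)
      then show ?thesis
        using 2 ijk raise_down_raise[of i j m w] raise_commute[of i j w] by (simp add: down_m)
    next
      case 3
      then have "m \<in> {1..s}" "l \<in> {1..s}" "m \<le> l"
        using ijk by (auto simp: m_def l_def)
      then show ?thesis
        using 3 ijk down_raise_down[of i l m w] down_commute[of l m "g i w"]
        by (simp add: down_m down_l)
    next
      case 4
      then have "m \<in> {1..s}" "l \<in> {1..s}" "q \<in> {1..s}"
        using ijk by (auto simp: m_def l_def q_def)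
      then show ?thesis
        using down_commute[of l m "g i w"] down_commute[of q l w]
        by (simp add: down_m down_l down_q)
    qed
  qed
  then show ?thesis
    using uv by (auto simp: fun_eq_iff)
qed

text \<open>The key to recovering the parameters: the element \<open>a\<^bsub>n+1-k\<^esub> a\<^sub>k\<close> of the monoid acts on the
  whole module as the scalar \<open>\<lambda>\<^sub>k\<close>.\<close>

lemma down_raise: "k \<in> {1..s} \<Longrightarrow> down k (g k v) = scale (lam k) v"
proof (rule linear_eq_on_basis[where f = "\<lambda>v. down k (g k v)"])
  fix i
  assume k: "k \<in> {1..s}" and i: "i \<in> multi_indices s"
  have "lowerable s k (raise_from s k i)"
    by (simp add: lowerable_def)
  moreover have "lower_from s k (raise_from s k i) = i"
    using i by (intro multi_indices_eqI[where s = s]) auto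
  ultimately show "down k (g k (e i)) = scale (lam k) (e i)"
    using k i by (simp add: operator_simps)
qed (auto intro!: linear_comp[OF linear_down linear_g] linear_scale_self)

text \<open>Lowering from position \<open>k\<close> on after raising from position \<open>k + 1\<close> on changes the single entry
  at position \<open>k\<close>, and similarly for raising.  There is no position after \<open>s\<close>, so at \<open>k = s\<close>
  the correcting factor is absent.\<close>

definition lower_at :: "nat \<Rightarrow> 'v \<Rightarrow> 'v" where
  "lower_at k v = down k (if k < s then g (k + 1) v else v)"

definition raise_at :: "nat \<Rightarrow> 'v \<Rightarrow> 'v" where
  "raise_at k v = (if k < s then down (k + 1) (g k v) else g k v)"

definition lower_coeff :: "nat \<Rightarrow> 'k" where
  "lower_coeff k = (if k < s then lam (k + 1) else 1)"

lemma raise_at_basis: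
  assumes k: "k \<in> {1..s}" and i: "i \<in> multi_indices s"
  shows "raise_at k (e i) = scale (lam k) (e (i(k := Suc (i k))))"
proof (cases "k < s")
  case True
  have "lowerable s (k + 1) (raise_from s k i)"
    by (simp add: lowerable_def)
  moreover have "lower_from s (k + 1) (raise_from s k i) = i(k := Suc (i k))"
    using multi_indices_update[OF i k] by (intro multi_indices_eqI[where s = s]) auto
  ultimately show ?thesis
    using True k i by (simp add: raise_at_def operator_simps)
next
  case False
  then have "raise_from s k i = i(k := Suc (i k))"
    using k multi_indices_update[OF i k] by (intro multi_indices_eqI[where s = s]) auto
  then show ?thesis
    using False k i by (simp add: raise_at_def operator_simps)
qed

lemma lower_at_basis:
  assumes k: "k \<in> {1..s}" and i: "i \<in> multi_indices s"
  shows "lower_at k (e i) =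
    (if i k > 0 then scale (lower_coeff k) (e (i(k := i k - 1))) else 0)"
proof (cases "k < s")
  case True
  have "lowerable s k (raise_from s (k + 1) i) \<longleftrightarrow> i k > 0"
    using k by (auto simp: lowerable_def less_Suc_eq)
  moreover have "lower_from s k (raise_from s (k + 1) i) = i(k := i k - 1)"
    using multi_indices_update[OF i k] by (intro multi_indices_eqI[where s = s]) auto
  ultimately show ?thesis
    using True k i by (simp add: lower_at_def lower_coeff_def operator_simps)
next
  case False
  then have "k = s"
    using k by simp
  then have "lowerable s k i \<longleftrightarrow> i k > 0"
    using k by (auto simp: lowerable_def)
  moreover have "lower_from s k i = i(k := i k - 1)"
    using False k multi_indices_update[OF i k] by (intro multi_indices_eqI[where s = s]) auto
  ultimately show ?thesis
    using False k i by (simp add: lower_at_def lower_coeff_def operator_simps)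
qed

lemma linear_lower_at: "k \<in> {1..s} \<Longrightarrow> Vector_Spaces.linear scale scale (lower_at k)"
  by (cases "k < s") (auto simp: lower_at_def[abs_def] intro!: linear_comp[OF linear_down linear_g] linear_down)

text \<open>In coordinates the operator is a shift followed by a scalar.  No two coordinates of \<open>v\<close> are
  added up, so that nothing can cancel.\<close>

lemma coord_lower_at:
  assumes k: "k \<in> {1..s}" and j: "j \<in> multi_indices s"
  shows "coord (lower_at k v) j = lower_coeff k * coord v (j(k := Suc (j k)))"
proof (rule linear_eq_on_basis[where f = "\<lambda>v. coord (lower_at k v) j"])
  show "Vector_Spaces.linear scale (*) (\<lambda>v. coord (lower_at k v) j)"
    using Vector_Spaces.linear_compose[OF linear_lower_at[OF k] linear_coord] by (simp add: o_def)
  show "Vector_Spaces.linear scale (*) (\<lambda>v. lower_coeff k * coord v (j(k := Suc (j k))))"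
    using Vector_Spaces.linear_compose[OF linear_coord
        vector_space.linear_scale_self[OF vector_space_field]] by (simp add: o_def)
  fix i
  assume i: "i \<in> multi_indices s"
  have "j = i(k := i k - 1) \<longleftrightarrow> j(k := Suc (j k)) = i" if "i k > 0"
    using that by auto
  moreover have "j(k := Suc (j k)) \<noteq> i" if "i k = 0"
    using that by auto
  ultimately show "coord (lower_at k (e i)) j = lower_coeff k * coord (e i) (j(k := Suc (j k)))"
    using i j k by (auto simp: lower_at_basis coord_scale coord_zero coord_basis multi_indices_update)
qed

definition height :: "(nat \<Rightarrow> nat) \<Rightarrow> nat" where
  "height i = (\<Sum>k=1..s. i k)"

lemma height_increment: "k \<in> {1..s} \<Longrightarrow> height (j(k := Suc (j k))) = Suc (height j)"
proof -
  assume "k \<in> {1..s}"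
  then have "height j' = j' k + (\<Sum>l\<in>{1..s} - {k}. j' l)" for j'
    unfolding height_def by (intro sum.remove) auto
  then show "height (j(k := Suc (j k))) = Suc (height j)"
    by simp
qed

definition origin :: "nat \<Rightarrow> nat" where
  "origin = (\<lambda>k\<in>{1..s}. 0)"

lemma origin_in: "origin \<in> multi_indices s"
  by (simp add: origin_def multi_indices_def)

lemma multi_index_cases:
  assumes i: "i \<in> multi_indices s"
  obtains "i = origin"
  | k j where "k \<in> {1..s}" "j \<in> multi_indices s" "i = j(k := Suc (j k))"
proof (cases "\<forall>k\<in>{1..s}. i k = 0")
  case True
  then have "i = origin"
    by (intro multi_indices_eqI[OF i origin_in]) (simp add: origin_def)
  then show ?thesis
    by (rule that(1))
next
  case False
  then obtain k where k: "k \<in> {1..s}" "i k > 0"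
    by blast
  show ?thesis
  proof (rule that(2)[OF k(1)])
    show "i(k := i k - 1) \<in> multi_indices s"
      by (rule multi_indices_update[OF i k(1)])
    show "i = (i(k := i k - 1))(k := Suc ((i(k := i k - 1)) k))"
      using k(2) by auto
  qed
qed

text \<open>The set \<open>N\<close> stands for a submodule.  Closure under addition enters only in the last step: a
  single nonzero vector is moved to \<open>e origin\<close>, and from there to every basis vector, by words in
  the generators and scalars alone.\<close>

context
  fixes N :: "'v set"
  assumes N_scale: "v \<in> N \<Longrightarrow> scale c v \<in> N"
    and N_g: "j \<in> {1..2 * s} \<Longrightarrow> v \<in> N \<Longrightarrow> g j v \<in> N"
    and lam_nonzero: "j \<in> {1..s} \<Longrightarrow> lam j \<noteq> 0"
begin

lemma N_down: "m \<in> {1..s} \<Longrightarrow> v \<in> N \<Longrightarrow> down m v \<in> N"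
  unfolding down_def by (rule N_g) auto

lemma N_unscale: "c \<noteq> 0 \<Longrightarrow> scale c v \<in> N \<Longrightarrow> v \<in> N"
  using N_scale[of "scale c v" "inverse c"] by simp

text \<open>Induction on a strict bound \<open>d\<close> for the heights of the indices in \<open>v\<close>.  Either some
  \<open>lower_at k v\<close> is nonzero, and its heights are bounded by \<open>d - 1\<close>; or all of them vanish, which
  by \<open>coord_lower_at\<close> leaves no coordinate but the one at the origin.\<close>

lemma origin_in_invariant:
  assumes "v \<in> N" "v \<noteq> 0" and "\<And>i. i \<in> multi_indices s \<Longrightarrow> coord v i \<noteq> 0 \<Longrightarrow> height i < d"
  shows "e origin \<in> N"
  using assms
proof (induction d arbitrary: v)
  case 0
  then have "v = 0"
    by (intro eq_if_coord_eq) (auto simp: coord_zero)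
  with 0 show ?case
    by simp
next
  case (Suc d)
  show ?case
  proof (cases "\<exists>k\<in>{1..s}. lower_at k v \<noteq> 0")
    case True
    then obtain k where k: "k \<in> {1..s}" "lower_at k v \<noteq> 0"
      by blast
    show ?thesis
    proof (rule Suc.IH)
      show "lower_at k v \<in> N"
        using k(1) Suc.prems(1) by (auto simp: lower_at_def intro!: N_down N_g)
      fix j
      assume j: "j \<in> multi_indices s" "coord (lower_at k v) j \<noteq> 0"
      then have "coord v (j(k := Suc (j k))) \<noteq> 0"
        by (simp add: coord_lower_at[OF k(1)])
      then have "height (j(k := Suc (j k))) < Suc d"
        by (intro Suc.prems multi_indices_update j(1) k(1))
      then show "height j < d"
        by (simp add: height_increment[OF k(1)])
    qed (fact k(2))
  next
    case False
    have "coord v i = 0" if i: "i \<in> multi_indices s" "i \<noteq> origin" for i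
      using i(1)
    proof (cases rule: multi_index_cases)
      case (2 k j)
      have "lower_coeff k * coord v i = coord (lower_at k v) j"
        using 2 by (simp add: coord_lower_at)
      also have "\<dots> = 0"
        using False 2 by (simp add: coord_zero)
      finally show ?thesis
        using 2(1) lam_nonzero[of "k + 1"] by (auto simp: lower_coeff_def split: if_splits)
    qed (use i in simp)
    then have v: "v = scale (coord v origin) (e origin)"
      by (intro eq_if_coord_eq) (auto simp: coord_scale coord_basis origin_in)
    with Suc.prems have "coord v origin \<noteq> 0"
      by (metis scale_zero_left)
    with v Suc.prems(1) show ?thesis
      by (metis N_unscale)
  qed
qed

text \<open>Every index other than the origin is some \<open>j\<close> with one entry raised, and \<open>raise_at\<close>
  realises this raise up to a nonzero scalar.\<close>

lemma basis_in_invariant: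
  assumes "e origin \<in> N"
  shows "i \<in> multi_indices s \<Longrightarrow> e i \<in> N"
proof (induction "height i" arbitrary: i rule: less_induct)
  case less
  from less.prems show ?case
  proof (cases rule: multi_index_cases)
    case 1
    then show ?thesis
      using assms by simp
  next
    case (2 k j)
    then have "e j \<in> N"
      by (intro less.hyps) (simp_all add: height_increment)
    then have "raise_at k (e j) \<in> N"
      using 2(1) by (auto simp: raise_at_def intro!: N_down N_g)
    then show ?thesis
      using 2 lam_nonzero by (auto simp: raise_at_basis intro: N_unscale)
  qed
qed

lemma invariant_eq_UNIV:
  assumes "\<And>v w. v \<in> N \<Longrightarrow> w \<in> N \<Longrightarrow> v + w \<in> N" and "v \<in> N" "v \<noteq> 0"
  shows "N = UNIV"
proof -
  \<comment> \<open>Only finitely many coordinates are nonzero, so the sum of their heights bounds each of them.\<close>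
  let ?d = "Suc (\<Sum>i\<in>{i\<in>multi_indices s. coord v i \<noteq> 0}. height i)"
  have "height i < ?d" if "i \<in> multi_indices s" "coord v i \<noteq> 0" for i
    using that finite_coord[of v] by (auto simp: less_Suc_eq_le intro!: member_le_sum)
  then have "e origin \<in> N"
    using assms(2,3) by (intro origin_in_invariant) auto
  then have "e ` multi_indices s \<subseteq> N"
    using basis_in_invariant by auto
  moreover have "subspace N"
    using assms(1,2) N_scale[of v 0] N_scale by (intro subspaceI) auto
  ultimately have "span (e ` multi_indices s) \<subseteq> N"
    by (rule span_minimal)
  then show ?thesis
    by (auto simp: span_basis)
qed

end

end


section \<open>Modules over a monoid algebra are determined by the generators\<close>

text \<open>The linear structure of the space is the one given by the multiples of the identity of the
  monoid; since these are central in the algebra, monoid elements act linearly.\<close>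

locale monoid_algebra_module = Group.monoid G + vector_space scale
  for G :: "('m, 'r) monoid_scheme" and scale :: "'k::field \<Rightarrow> 'v::ab_group_add \<Rightarrow> 'v" +
  fixes act :: "('m \<Rightarrow> 'k) \<Rightarrow> 'v \<Rightarrow> 'v"
  assumes left_module: "left_module (monoid_algebra G) (type_module act)"
    and act_scalar: "act (alg_monom c \<one>\<^bsub>G\<^esub>) v = scale c v"
begin

lemma act_add:
  "f \<in> carrier (monoid_algebra G) \<Longrightarrow> f' \<in> carrier (monoid_algebra G) \<Longrightarrow>
    act (\<lambda>x. f x + f' x) v = act f v + act f' v"
  using left_module.smult_l_distr[OF left_module, of f f' v]
  by (simp add: type_module_def monoid_algebra_add)

lemma act_add_right: "f \<in> carrier (monoid_algebra G) \<Longrightarrow> act f (v + w) = act f v + act f w"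
  using left_module.smult_r_distr[OF left_module, of f v w] by (simp add: type_module_def)

lemma act_mult:
  "f \<in> carrier (monoid_algebra G) \<Longrightarrow> f' \<in> carrier (monoid_algebra G) \<Longrightarrow>
    act (f \<otimes>\<^bsub>monoid_algebra G\<^esub> f') v = act f (act f' v)"
  using left_module.smult_assoc[OF left_module, of f f' v] by (simp add: type_module_def)

lemma act_monom_mult:
  "x \<in> carrier G \<Longrightarrow> y \<in> carrier G \<Longrightarrow>
    act (alg_monom (c * d) (x \<otimes>\<^bsub>G\<^esub> y)) v = act (alg_monom c x) (act (alg_monom d y) v)"
  by (simp add: act_mult alg_monom_in_carrier flip: alg_monom_mult)

lemma act_monom: "x \<in> carrier G \<Longrightarrow> act (alg_monom c x) v = scale c (act (alg_monom 1 x) v)"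
  using act_monom_mult[of "\<one>\<^bsub>G\<^esub>" x c 1 v] by (simp add: act_scalar)

lemma linear_act_monom:
  assumes x: "x \<in> carrier G"
  shows "Vector_Spaces.linear scale scale (act (alg_monom 1 x))"
proof unfold_locales
  show "act (alg_monom 1 x) (v + w) = act (alg_monom 1 x) v + act (alg_monom 1 x) w" for v w
    using x by (intro act_add_right alg_monom_in_carrier)
  show "act (alg_monom 1 x) (scale c v) = scale c (act (alg_monom 1 x) v)" for c v
    using act_monom_mult[OF x one_closed, of 1 c v] act_monom[OF x, of c v] x
    by (simp add: act_scalar)
qed

text \<open>Induction on a finite set that contains the support, splitting off one monomial at a time.\<close>

lemma act_eq_linear_extension:
  assumes "f \<in> carrier (monoid_algebra G)"
  shows "act f v = linear_extension scale (\<lambda>x. act (alg_monom 1 x) v) f"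
proof -
  have "act f v = linear_extension scale (\<lambda>x. act (alg_monom 1 x) v) f"
    if "finite A" "A \<subseteq> carrier G" "support f \<subseteq> A" for A f
    using that
  proof (induction A arbitrary: f rule: finite_induct)
    case empty
    \<comment> \<open>The zero element is written as a monomial because the scalar 0 acts as 0.\<close>
    then have "f = alg_monom 0 \<one>\<^bsub>G\<^esub>"
      by (auto simp: alg_monom_def)
    then show ?case
      by (simp only: linear_extension_monom act_scalar) simp
  next
    case (insert x A)
    define f' where "f' = f(x := 0)"
    have f: "f = (\<lambda>y. f' y + alg_monom (f x) x y)"
      by (auto simp: f'_def alg_monom_def)
    have A: "A \<subseteq> carrier G" and x: "x \<in> carrier G"
      using insert.prems by auto
    have supp: "support f' \<subseteq> A"
      using insert.prems by (auto simp: f'_def)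
    then have fin: "finite (support f')"
      using insert.hyps(1) by (rule finite_subset)
    have in_carrier: "f' \<in> carrier (monoid_algebra G)"
      using supp fin A by (auto simp: monoid_algebra_carrier)
    have monom: "alg_monom (f x) x \<in> carrier (monoid_algebra G)"
      using x by (rule alg_monom_in_carrier)
    have "act f v = act f' v + act (alg_monom (f x) x) v"
      by (subst f) (rule act_add[OF in_carrier monom])
    also have "\<dots> = linear_extension scale (\<lambda>x. act (alg_monom 1 x) v) f' +
        linear_extension scale (\<lambda>x. act (alg_monom 1 x) v) (alg_monom (f x) x)"
      by (simp only: insert.IH[OF A supp] linear_extension_monom act_monom[OF x, of "f x"])
    also have "\<dots> = linear_extension scale (\<lambda>x. act (alg_monom 1 x) v) f"
      using monom linear_extension_add[OF fin, of "alg_monom (f x) x"]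
      by (simp add: monoid_algebra_carrier flip: f)
    finally show ?case .
  qed
  then show ?thesis
    using assms by (auto simp: monoid_algebra_carrier)
qed

end

lemma act_word_class:
  fixes scale :: "'k::field \<Rightarrow> 'v::ab_group_add \<Rightarrow> 'v"
  assumes "monoid_algebra_module (presented_monoid A R) scale act" and "w \<in> lists A"
  shows "act (alg_monom 1 (word_cong A R `` {w})) v =
    foldr (\<lambda>a. act (alg_monom 1 (presented_gen A R a))) w v"
  using assms(2)
proof (induction w)
  case Nil
  interpret monoid_algebra_module "presented_monoid A R" scale act by fact
  show ?case
    using act_scalar[of 1 v] by (simp add: one_presented_monoid)
next
  case (Cons a w)
  interpret monoid_algebra_module "presented_monoid A R" scale act by fact
  have "[a] \<in> lists A" "w \<in> lists A"
    using Cons.hyps by auto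
  then have "act (alg_monom 1 (word_cong A R `` {[a] @ w})) v =
    act (alg_monom 1 (presented_gen A R a)) (act (alg_monom 1 (word_cong A R `` {w})) v)"
    using act_monom_mult[of "word_cong A R `` {[a]}" "word_cong A R `` {w}" 1 1 v]
    by (simp only: word_class_mult word_class_in_carrier presented_gen_def mult_1)
  then show ?case
    by (simp add: Cons.IH)
qed


section \<open>The modules of the Chinese monoid\<close>

lemma chinese_gen_in_carrier: "j \<in> {1..n} \<Longrightarrow> chinese_gen n j \<in> carrier (chinese_monoid n)"
  by (simp add: chinese_gen_def chinese_monoid_def presented_gen_def word_class_in_carrier)

lemma monoid_chinese_monoid: "Group.monoid (chinese_monoid n)"
  by (simp add: chinese_monoid_def monoid_presented_monoid)

lemma chinese_module_structureD:
  assumes "vector_space scale" and "chinese_module_structure n s scale e lam act"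
  shows "monoid_algebra_module (chinese_monoid n) scale act"
    and "j \<in> {1..n} \<Longrightarrow> i \<in> multi_indices s \<Longrightarrow>
      act (alg_monom 1 (chinese_gen n j)) (e i) = basis_action n s scale e lam j i"
proof -
  show "monoid_algebra_module (chinese_monoid n) scale act"
    using assms(2) unfolding chinese_module_structure_def
    by (intro monoid_algebra_module.intro monoid_algebra_module_axioms.intro
        monoid_chinese_monoid assms(1)) blast+
  show "j \<in> {1..n} \<Longrightarrow> i \<in> multi_indices s \<Longrightarrow>
      act (alg_monom 1 (chinese_gen n j)) (e i) = basis_action n s scale e lam j i"
    using assms(2) by (simp add: chinese_module_structure_def)
qed

lemma chinese_operators_of_module:
  assumes "indexed_basis scale (multi_indices s) e"
    and "chinese_module_structure (2 * s) s scale e lam act"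
  shows "chinese_operators scale s e lam (\<lambda>j. act (alg_monom 1 (chinese_gen (2 * s) j)))"
proof -
  interpret indexed_basis scale "multi_indices s" e by fact
  note module_structure = chinese_module_structureD[OF vector_space_axioms assms(2)]
  interpret monoid_algebra_module "chinese_monoid (2 * s)" scale act
    by (rule module_structure(1))
  show ?thesis
    by (intro chinese_operators.intro chinese_operators_axioms.intro assms(1))
      (simp_all only: linear_act_monom chinese_gen_in_carrier module_structure(2))
qed

text \<open>The action is determined by the monomials, these by the words in the generators, and the
  generators by their values on the basis.  Two parameter families that
  agree on \<open>{1..s}\<close> are allowed, so that the same statement also gives the isomorphism of modules with
  equal parameters.\<close>

lemma chinese_module_unique:
  assumes "indexed_basis scale (multi_indices s) e"
    and "chinese_module_structure (2 * s) s scale e lam act"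
    and "chinese_module_structure (2 * s) s scale e mu act'"
    and eq: "\<And>j. j \<in> {1..s} \<Longrightarrow> lam j = mu j"
    and f: "f \<in> carrier (monoid_algebra (chinese_monoid (2 * s)))"
  shows "act f v = act' f v"
proof -
  let ?C = "chinese_monoid (2 * s)"
  let ?g = "\<lambda>j. act (alg_monom 1 (chinese_gen (2 * s) j))"
  let ?g' = "\<lambda>j. act' (alg_monom 1 (chinese_gen (2 * s) j))"
  interpret indexed_basis scale "multi_indices s" e by fact
  interpret A: monoid_algebra_module ?C scale act
    by (rule chinese_module_structureD[OF vector_space_axioms assms(2)])
  interpret A': monoid_algebra_module ?C scale act'
    by (rule chinese_module_structureD[OF vector_space_axioms assms(3)])
  interpret O: chinese_operators scale s e lam ?g
    by (rule chinese_operators_of_module[OF assms(1,2)])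
  interpret O': chinese_operators scale s e mu ?g'
    by (rule chinese_operators_of_module[OF assms(1,3)])
  have gen: "?g j v = ?g' j v" if j: "j \<in> {1..2 * s}" for j v
  proof (rule linear_eq_on_basis[where f = "?g j" and f' = "?g' j"])
    show "Vector_Spaces.linear scale scale (?g j)"
      using j by (rule O.linear_g)
    show "Vector_Spaces.linear scale scale (?g' j)"
      using j by (rule O'.linear_g)
    show "?g j (e i) = ?g' j (e i)" if "i \<in> multi_indices s" for i
      using j that eq by (simp only: O.g_basis O'.g_basis) (auto simp: basis_action_def)
  qed
  have word: "foldr ?g w v = foldr ?g' w v" if "w \<in> lists {1..2 * s}" for w v
    using that by (induction w) (simp_all add: gen)
  have "act (alg_monom 1 x) v = act' (alg_monom 1 x) v" if "x \<in> carrier ?C" for x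
  proof -
    obtain w where w: "w \<in> lists {1..2 * s}"
      and x: "x = word_cong {1..2 * s} (chinese_rels (2 * s)) `` {w}"
      using \<open>x \<in> carrier ?C\<close> unfolding chinese_monoid_def by (rule word_classE)
    note A.monoid_algebra_module_axioms[unfolded chinese_monoid_def]
      A'.monoid_algebra_module_axioms[unfolded chinese_monoid_def]
    then show ?thesis
      using word[OF w, of v] unfolding x chinese_gen_def by (simp only: act_word_class[OF _ w])
  qed
  then have "linear_extension scale (\<lambda>x. act (alg_monom 1 x) v) f =
      linear_extension scale (\<lambda>x. act' (alg_monom 1 x) v) f"
    using f unfolding linear_extension_def monoid_algebra_carrier
    by (intro sum.cong HOL.refl) auto
  then show ?thesis
    by (simp only: A.act_eq_linear_extension[OF f] A'.act_eq_linear_extension[OF f])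
qed

lemma chinese_module_exists:
  assumes "indexed_basis scale (multi_indices s) e"
  shows "\<exists>act. chinese_module_structure (2 * s) s scale e lam act"
proof -
  let ?A = "{1..2 * s}" and ?R = "chinese_rels (2 * s)" and ?C = "chinese_monoid (2 * s)"
  interpret indexed_basis scale "multi_indices s" e by fact
  have "\<exists>g. \<forall>j. Vector_Spaces.linear scale scale (g j) \<and>
      (\<forall>i\<in>multi_indices s. g j (e i) = basis_action (2 * s) s scale e lam j i)"
    by (intro choice allI linear_map_exists)
  then obtain g where linear: "Vector_Spaces.linear scale scale (g j)"
    and basis: "i \<in> multi_indices s \<Longrightarrow> g j (e i) = basis_action (2 * s) s scale e lam j i" for i j
    by blast
  interpret chinese_operators scale s e lam g
    by (intro chinese_operators.intro chinese_operators_axioms.intro assms)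
      (simp_all only: linear basis)
  have class_eq: "class_action g (word_cong ?A ?R `` {w}) = foldr g w" if "w \<in> lists ?A" for w
    using chinese_relations that by (rule class_action_class)
  have one: "class_action g \<one>\<^bsub>?C\<^esub> v = v" for v
    by (simp only: chinese_monoid_def one_presented_monoid class_eq[OF lists.Nil]) simp
  have linear_foldr: "Vector_Spaces.linear scale scale (foldr g w)" for w
  proof (induction w)
    case Nil
    show ?case
      using linear_id by (simp add: id_def)
  next
    case (Cons a w)
    then show ?case
      using Vector_Spaces.linear_compose[OF Cons.IH linear[of a]] by (simp add: o_def)
  qed
  let ?act = "\<lambda>f v. linear_extension scale (\<lambda>x. class_action g x v) f"
  have "left_module (monoid_algebra ?C) (type_module ?act)"
  proof (rule left_module_of_representation[OF monoid_chinese_monoid vector_space_axioms])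
    fix x
    assume "x \<in> carrier ?C"
    then obtain u where u: "u \<in> lists ?A" "x = word_cong ?A ?R `` {u}"
      unfolding chinese_monoid_def by (rule word_classE)
    then show "Vector_Spaces.linear scale scale (class_action g x)"
      by (simp only: class_eq linear_foldr)
    fix y v
    assume "y \<in> carrier ?C"
    then obtain w where w: "w \<in> lists ?A" "y = word_cong ?A ?R `` {w}"
      unfolding chinese_monoid_def by (rule word_classE)
    have "u @ w \<in> lists ?A"
      using u w by simp
    then show "class_action g (x \<otimes>\<^bsub>?C\<^esub> y) v = class_action g x (class_action g y v)"
      by (simp only: u(2) w(2) chinese_monoid_def word_class_mult[OF u(1) w(1)]
          class_eq u(1) w(1) foldr_append o_apply)
  next
    show "class_action g \<one>\<^bsub>?C\<^esub> v = v" for v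
      by (rule one)
  qed
  moreover have "?act (alg_monom c \<one>\<^bsub>?C\<^esub>) v = scale c v" for c v
    by (simp only: linear_extension_monom one)
  moreover have "?act (alg_monom 1 (chinese_gen (2 * s) j)) (e i) =
    basis_action (2 * s) s scale e lam j i" if "j \<in> ?A" "i \<in> multi_indices s" for i j
  proof -
    have "[j] \<in> lists ?A"
      using that by simp
    then show ?thesis
      using basis[OF that(2), of j]
      by (simp only: linear_extension_monom chinese_gen_def presented_gen_def class_eq) simp
  qed
  ultimately have "chinese_module_structure (2 * s) s scale e lam ?act"
    unfolding chinese_module_structure_def by blast
  then show ?thesis
    by blast
qed

lemma chinese_module_simple:
  assumes "indexed_basis scale (multi_indices s) e"
    and lam: "\<And>j. j \<in> {1..s} \<Longrightarrow> lam j \<noteq> 0"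
    and module_structure: "chinese_module_structure (2 * s) s scale e lam act"
  shows "simple_left_module (monoid_algebra (chinese_monoid (2 * s))) (type_module act)"
proof -
  let ?R = "monoid_algebra (chinese_monoid (2 * s))" and ?M = "type_module act"
  let ?g = "\<lambda>j. act (alg_monom 1 (chinese_gen (2 * s) j))"
  interpret indexed_basis scale "multi_indices s" e by fact
  interpret A: monoid_algebra_module "chinese_monoid (2 * s)" scale act
    by (rule chinese_module_structureD[OF vector_space_axioms module_structure])
  interpret O: chinese_operators scale s e lam ?g
    by (rule chinese_operators_of_module[OF assms(1) module_structure])
  have M: "carrier ?M = UNIV" "\<zero>\<^bsub>?M\<^esub> = 0"
    by (simp_all add: type_module_def)
  have "N = {0} \<or> N = UNIV" if N: "submodule N ?R ?M" for N
  proof (cases "N \<subseteq> {0}")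
    case True
    have "0 \<in> N"
      using subgroup.one_closed[OF submodule.axioms(1)[OF N]] by (simp add: type_module_def)
    with True show ?thesis
      by blast
  next
    case False
    then obtain v where v: "v \<in> N" "v \<noteq> 0"
      by blast
    have smult: "act f w \<in> N" if "f \<in> carrier ?R" "w \<in> N" for f w
      using submodule.smult_closed[OF N that] by (simp add: type_module_def)
    have "N = UNIV"
    proof (rule O.invariant_eq_UNIV)
      show "w + w' \<in> N" if "w \<in> N" "w' \<in> N" for w w'
        using subgroup.m_closed[OF submodule.axioms(1)[OF N] that] by (simp add: type_module_def)
      show "scale c w \<in> N" if "w \<in> N" for c w
        using smult[OF alg_monom_in_carrier[OF A.one_closed] that, of c] by (simp only: A.act_scalar)
      show "?g j w \<in> N" if "j \<in> {1..2 * s}" "w \<in> N" for j w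
        using that by (intro smult alg_monom_in_carrier chinese_gen_in_carrier)
    qed (fact lam v)+
    then show ?thesis
      by blast
  qed
  moreover have "carrier ?M \<noteq> {\<zero>\<^bsub>?M\<^esub>}"
    using basis_nonzero[OF O.origin_in] unfolding M by blast
  ultimately show ?thesis
    using A.left_module by (auto simp: simple_left_module_def M)
qed

text \<open>An isomorphism commutes with the element that acts as the scalar \<open>\<lambda>\<^sub>k\<close> on one side and as
  \<open>\<mu>\<^sub>k\<close> on the other; evaluating at any nonzero vector gives \<open>\<lambda>\<^sub>k = \<mu>\<^sub>k\<close>.\<close>

lemma eigenvalues_of_isomorphic_modules:
  assumes "indexed_basis scale (multi_indices s) e"
    and "chinese_module_structure (2 * s) s scale e lam act"
    and "chinese_module_structure (2 * s) s scale e mu act'"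
    and "left_module_isomorphic (monoid_algebra (chinese_monoid (2 * s)))
      (type_module act) (type_module act')"
    and k: "k \<in> {1..s}"
  shows "lam k = mu k"
proof -
  let ?C = "chinese_monoid (2 * s)"
  let ?g = "\<lambda>j. act (alg_monom 1 (chinese_gen (2 * s) j))"
  let ?g' = "\<lambda>j. act' (alg_monom 1 (chinese_gen (2 * s) j))"
  interpret indexed_basis scale "multi_indices s" e by fact
  interpret A: monoid_algebra_module ?C scale act
    by (rule chinese_module_structureD[OF vector_space_axioms assms(2)])
  interpret A': monoid_algebra_module ?C scale act'
    by (rule chinese_module_structureD[OF vector_space_axioms assms(3)])
  interpret O: chinese_operators scale s e lam ?g
    by (rule chinese_operators_of_module[OF assms(1,2)])
  interpret O': chinese_operators scale s e mu ?g'
    by (rule chinese_operators_of_module[OF assms(1,3)])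
  obtain h where "inj h" and h_add: "\<And>v w. h (v + w) = h v + h w"
    and h_act: "\<And>f v. f \<in> carrier (monoid_algebra ?C) \<Longrightarrow> h (act f v) = act' f (h v)"
    using assms(4) by (auto simp: left_module_isomorphic_def type_module_def bij_betw_def)
  have h_scale: "h (scale c v) = scale c (h v)" for c v
    using h_act[OF alg_monom_in_carrier[OF A.one_closed]] by (simp only: A.act_scalar A'.act_scalar)
  have h_g: "h (?g j v) = ?g' j (h v)" if "j \<in> {1..2 * s}" for j v
    using that by (intro h_act alg_monom_in_carrier chinese_gen_in_carrier)
  have "h 0 = 0"
    using h_add[of 0 0] by simp
  then have "h (e O.origin) \<noteq> 0"
    using basis_nonzero[OF O.origin_in] \<open>inj h\<close> by (metis injD)
  moreover have "scale (lam k) (h (e O.origin)) = scale (mu k) (h (e O.origin))"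
  proof -
    have "scale (lam k) (h (e O.origin)) = h (O.down k (?g k (e O.origin)))"
      by (simp only: O.down_raise[OF k] h_scale)
    also have "\<dots> = O'.down k (?g' k (h (e O.origin)))"
    proof -
      have "k \<in> {1..2 * s}" "2 * s + 1 - k \<in> {1..2 * s}"
        using k by auto
      then show ?thesis
        unfolding O.down_def O'.down_def by (simp only: h_g)
    qed
    also have "\<dots> = scale (mu k) (h (e O.origin))"
      by (rule O'.down_raise[OF k])
    finally show ?thesis .
  qed
  ultimately show ?thesis
    by simp
qed

theorem proposition3p2:
  fixes scale :: "'k::alg_closed_field \<Rightarrow> 'v::ab_group_add \<Rightarrow> 'v"
    and e :: "(nat \<Rightarrow> nat) \<Rightarrow> 'v"
    and lam :: "nat \<Rightarrow> 'k"
    and s n :: nat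
  assumes "uncountable (UNIV :: 'k set)"
    and "s \<ge> 1" and "n = 2 * s"
    and "vector_space scale"
    and "basis_family scale (multi_indices s) e"
    and "\<forall>j\<in>{1..s}. lam j \<noteq> 0"
  shows "(\<exists>act. chinese_module_structure n s scale e lam act) \<and>
    (\<forall>act act'. chinese_module_structure n s scale e lam act \<longrightarrow>
       chinese_module_structure n s scale e lam act' \<longrightarrow>
       (\<forall>f\<in>carrier (monoid_algebra (chinese_monoid n)). \<forall>v. act f v = act' f v)) \<and>
    (\<forall>act. chinese_module_structure n s scale e lam act \<longrightarrow>
       simple_left_module (monoid_algebra (chinese_monoid n)) (type_module act)) \<and>
    (\<forall>mu act act'. (\<forall>j\<in>{1..s}. mu j \<noteq> 0) \<longrightarrow>
       chinese_module_structure n s scale e lam act \<longrightarrow>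
       chinese_module_structure n s scale e mu act' \<longrightarrow>
       (left_module_isomorphic (monoid_algebra (chinese_monoid n))
          (type_module act) (type_module act') \<longleftrightarrow> (\<forall>i\<in>{1..s}. lam i = mu i)))"
proof -
  have basis: "indexed_basis scale (multi_indices s) e"
    using assms(4,5) by (simp add: indexed_basis_def indexed_basis_axioms_def)
  show ?thesis
    unfolding \<open>n = 2 * s\<close>
  proof (intro conjI allI impI ballI)
    show "\<exists>act. chinese_module_structure (2 * s) s scale e lam act"
      by (rule chinese_module_exists[OF basis])
  next
    fix act act' :: "(nat list set \<Rightarrow> 'k) \<Rightarrow> 'v \<Rightarrow> 'v" and f :: "nat list set \<Rightarrow> 'k" and v
    assume "chinese_module_structure (2 * s) s scale e lam act"
      "chinese_module_structure (2 * s) s scale e lam act'"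
      "f \<in> carrier (monoid_algebra (chinese_monoid (2 * s)))"
    then show "act f v = act' f v"
      by (intro chinese_module_unique[OF basis]) auto
  next
    fix act
    assume "chinese_module_structure (2 * s) s scale e lam act"
    then show "simple_left_module (monoid_algebra (chinese_monoid (2 * s))) (type_module act)"
      using assms(6) by (intro chinese_module_simple[OF basis]) auto
  next
    fix mu act act'
    assume structures: "chinese_module_structure (2 * s) s scale e lam act"
      "chinese_module_structure (2 * s) s scale e mu act'"
    show "left_module_isomorphic (monoid_algebra (chinese_monoid (2 * s)))
        (type_module act) (type_module act') \<longleftrightarrow> (\<forall>i\<in>{1..s}. lam i = mu i)"
    proof
      assume "left_module_isomorphic (monoid_algebra (chinese_monoid (2 * s)))
        (type_module act) (type_module act')"
      then show "\<forall>i\<in>{1..s}. lam i = mu i"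
        using eigenvalues_of_isomorphic_modules[OF basis structures] by blast
    next
      assume eq: "\<forall>i\<in>{1..s}. lam i = mu i"
      have "act f v = act' f v" if "f \<in> carrier (monoid_algebra (chinese_monoid (2 * s)))" for f v
        using chinese_module_unique[OF basis structures _ that] eq by blast
      then show "left_module_isomorphic (monoid_algebra (chinese_monoid (2 * s)))
        (type_module act) (type_module act')"
        unfolding left_module_isomorphic_def
        by (intro exI[of _ id]) (simp add: type_module_def)
    qed
  qed
qed

end
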